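(* Let $T:[0,1)^2\to[0,1)^2$, $T(x,y)=(y,\{-x-\sqrt3y\})$ (the map associated with $\lambda=-\sqrt3$), and let $V(z)=\frac{(1,1)-z}{(2-\sqrt3)^2}$. Then $\pi(z)$ is finite for all $z\in(\mathbb Z[\sqrt3]\cap[0,1))^2$, but $\pi\left(V^{-1}\left(\frac27,\frac{\sqrt3}7+\frac17\right)\right)=\infty$.
   Context: $\{u\}=u-\lfloor u\rfloor$ is the fractional part. $T$ is a bijection of $[0,1)^2$. $\pi(z)$ is the least $p\ge1$ with $T^p(z)=z$, and $\pi(z)=\infty$ if no such $p$ exists. Explicitly $V^{-1}(w)=(1,1)-(2-\sqrt3)^2w$. *)

theory Defs
  imports "HOL-Analysis.Analysis" "HOL-Library.Extended_Nat"
begin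

text \<open>
  The formula makes sense on the whole plane; \<open>T\<close> maps the half-open unit square
  \<open>{0..<1} \<times> {0..<1}\<close> to itself, and it is only applied to points of that square.
\<close>
definition T :: "real \<times> real \<Rightarrow> real \<times> real" where
  "T = (\<lambda>(x, y). (y, frac (- x - sqrt 3 * y)))"

definition V :: "real \<times> real \<Rightarrow> real \<times> real" where
  "V z = ((1, 1) - z) /\<^sub>R (2 - sqrt 3)\<^sup>2"

definition period :: "real \<times> real \<Rightarrow> enat" where
  "period z = (if \<exists>p\<ge>1. (T ^^ p) z = z
               then enat (LEAST p. p \<ge> 1 \<and> (T ^^ p) z = z) else \<infinity>)"

definition Z_sqrt3 :: "real set" where
  "Z_sqrt3 = {of_int a + of_int b * sqrt 3 | a b :: int. True}"

end

theory Submission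
  imports Defs
begin

text \<open>
The map \<open>T\<close> is a piecewise rotation. In the coordinates used here its linear part is
\<open>rot ^^ 5\<close>, where \<open>rot\<close> is a rotation by 30 degrees for the quadratic form
\<open>x\<^sup>2 + sqrt 3 * x * y + y\<^sup>2\<close>, and on each of its pieces \<open>T\<close> adds a translation \<open>(0, k)\<close>.
Both claims rest on a renormalisation with ratio \<open>kappa = 2 - sqrt 3\<close>. Let \<open>triangle\<close> be the open
isosceles triangle with vertices \<open>(0, 0)\<close>, \<open>(1 / sqrt 3, 0)\<close>, \<open>(0, 1)\<close>, and let
\<open>Phi n w = (1, 1) - kappa ^ (n + 2) *\<^sub>R w\<close> place shrinking copies of it in the corner \<open>(1, 1)\<close> of
the square; \<open>Phi 0\<close> is the inverse of \<open>V\<close>. There are two piecewise isometries \<open>S 0 = S 2 = \<dots>\<close>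
and \<open>S 1 = S 3 = \<dots>\<close> of the triangle such that a positive iterate of \<open>T\<close> carries \<open>Phi n w\<close>
to \<open>Phi n (S n w)\<close> (lemma \<open>level\<close>). This holds for \<open>n = 0\<close> by following the pieces of the
triangle under \<open>T\<close>, and passes from \<open>n\<close> to \<open>n + 1\<close> because a positive iterate of \<open>S n\<close> carries
\<open>kappa *\<^sub>R w\<close> to \<open>kappa *\<^sub>R S (Suc n) w\<close> (lemma \<open>link_S\<close>). The two maps have the same three
open pieces and agree on them up to finitely many segments; they differ on those segments, which
lie on images of the half-open boundaries of the pieces of \<open>T\<close>, and this is why the parity of the
level matters.

Infinite orbit. The orbit of \<open>kappa *\<^sub>R w\<close> under \<open>S n\<close> contains the scaled orbit of \<open>w\<close> under
\<open>S (Suc n)\<close> and also a point outside the scaled triangle, so it is strictly larger if it is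
finite (lemma \<open>orbit_decreases\<close>). The point \<open>(2/7, sqrt 3/7 + 1/7)\<close> returns to itself after four
renormalisation steps, an even number. A finite orbit would therefore be strictly larger than
itself. The orbit of \<open>inv V\<close> of that point under \<open>T\<close> contains a copy of this infinite orbit.

Finite orbits. A point of the square has a finite orbit or enters \<open>Phi 0 ` triangle\<close>
(\<open>cover_T\<close>), and a point of the triangle has a finite orbit under \<open>S n\<close> or enters
\<open>kappa *\<^sub>R triangle\<close> after at most 19 steps (\<open>cover_S\<close>). Suppose that the coordinates lie in
\<open>\<int>[sqrt 3]\<close> and apply \<open>sqrt 3 \<mapsto> - sqrt 3\<close>. A step of \<open>S n\<close> moves the conjugate point by a
rotation and a bounded translation, while division by \<open>kappa\<close> multiplies the conjugate by
\<open>2 - sqrt 3 < 1\<close>. After enough renormalisation steps the conjugate is bounded by 25, and the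
lattice points of the triangle with such a conjugate form a finite list whose orbits close
(\<open>galois_descent\<close>).

The geometric facts are verified by a program on cells, which are convex polygons with sides in six
directions and bounds in \<open>(1/6) \<int>[sqrt 3]\<close>. The rotations, translations and cuts that occur
lead from such cells to such cells, so integer arithmetic suffices and the program can be
executed by rewriting.
\<close>

section \<open>The ring \<int>[sqrt 3]\<close>

definition zr :: "int \<Rightarrow> int \<Rightarrow> real" where
  "zr a b = of_int a + of_int b * sqrt 3"

lemma sqrt3_sq [simp]: "sqrt 3 * sqrt 3 = (3 :: real)" "sqrt 3 * (sqrt 3 * x) = 3 * (x :: real)"
  by (simp_all flip: mult.assoc)

lemma zr_add: "zr (a + c) (b + d) = zr a b + zr c d"
  and zr_diff: "zr (a - c) (b - d) = zr a b - zr c d"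
  and zr_minus: "zr (- a) (- b) = - zr a b"
  and zr_zero: "zr 0 0 = 0"
  by (simp_all add: zr_def algebra_simps)

lemma zr_mult: "zr a b * zr c d = zr (a * c + 3 * (b * d)) (a * d + b * c)"
  by (simp add: zr_def algebra_simps)

text \<open>
The sign of \<open>a + b * sqrt 3\<close> is decided with integers by comparing \<open>a\<^sup>2\<close> with \<open>3 * b\<^sup>2\<close>. The
conditionals replace conjunctions and disjunctions because rewriting evaluates the branches of a
conditional only on demand. The same style is used in all functions that are executed below.
\<close>

definition zpos :: "int \<Rightarrow> int \<Rightarrow> bool" where
  "zpos a b = (if 0 < a then if 0 \<le> b then True else 3 * (b * b) < a * a
               else if 0 < b then a * a < 3 * (b * b) else False)"

lemma zpos_iff: "zpos a b \<longleftrightarrow> 0 < zr a b"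
proof -
  let ?a = "of_int a :: real" and ?b = "of_int b * sqrt 3 :: real"
  have sq: "(of_int (3 * (b * b)) :: real) = ?b * ?b" by (simp add: algebra_simps)
  have lt1: "3 * (b * b) < a * a \<longleftrightarrow> \<bar>?b\<bar> < \<bar>?a\<bar>"
  proof -
    have "3 * (b * b) < a * a \<longleftrightarrow> ?b * ?b < ?a * ?a"
      unfolding sq[symmetric] of_int_mult[symmetric] of_int_less_iff ..
    also have "\<dots> \<longleftrightarrow> \<bar>?b\<bar> < \<bar>?a\<bar>"
      by (metis abs_le_square_iff power2_eq_square linorder_not_le)
    finally show ?thesis .
  qed
  have lt2: "a * a < 3 * (b * b) \<longleftrightarrow> \<bar>?a\<bar> < \<bar>?b\<bar>"
  proof -
    have "a * a < 3 * (b * b) \<longleftrightarrow> ?a * ?a < ?b * ?b"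
      unfolding sq[symmetric] of_int_mult[symmetric] of_int_less_iff ..
    also have "\<dots> \<longleftrightarrow> \<bar>?a\<bar> < \<bar>?b\<bar>"
      by (metis abs_le_square_iff power2_eq_square linorder_not_le)
    finally show ?thesis .
  qed
  have sgn: "0 < ?b \<longleftrightarrow> 0 < b" "?b < 0 \<longleftrightarrow> b < 0" "0 < ?a \<longleftrightarrow> 0 < a"
    by (auto simp: zero_less_mult_iff mult_less_0_iff)
  show ?thesis
    unfolding zpos_def zr_def lt1 lt2 using sgn by (auto split: if_splits)
qed

section \<open>Rotation by thirty degrees\<close>

text \<open>
In an oblique basis of the Euclidean plane, with an angle of 30 degrees between the unit vectors, this is the
rotation by \<open>- \<pi>/6\<close>. Its fifth power is the linear part of \<open>T\<close>.
\<close>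

definition rot :: "real \<times> real \<Rightarrow> real \<times> real" where
  "rot z = (sqrt 3 * fst z + snd z, - fst z)"

text \<open>
The twelve functionals \<open>e 0, \<dots>, e 11\<close> are normals of equal length at multiples of 30 degrees. All lines
along which \<open>T\<close> is discontinuous, their iterated images, and the sides of the square and of the
triangle are level sets of these functionals.
\<close>

definition e :: "nat \<Rightarrow> real \<times> real \<Rightarrow> real" where
  "e j z = fst ((rot ^^ j) z)"

lemma rot_linear: "rot (z + w) = rot z + rot w" "rot (z - w) = rot z - rot w" "rot (k *\<^sub>R z) = k *\<^sub>R rot z"
  by (simp_all add: rot_def algebra_simps)

lemma rot_pow_add: "(rot ^^ n) (z + w) = (rot ^^ n) z + (rot ^^ n) w"
  by (induction n) (simp_all add: rot_linear)

lemma rot_pow_diff: "(rot ^^ n) (z - w) = (rot ^^ n) z - (rot ^^ n) w"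
  by (induction n) (simp_all add: rot_linear)

lemma rot_pow_scale: "(rot ^^ n) (k *\<^sub>R z) = k *\<^sub>R (rot ^^ n) z"
  by (induction n) (simp_all add: rot_linear)

lemma rot_6: "(rot ^^ 6) z = - z"
  by (cases z) (simp add: rot_def numeral_eq_Suc algebra_simps)

lemma rot_12: "(rot ^^ 12) z = z"
  using rot_6[of "(rot ^^ 6) z"] rot_6[of z] funpow_add[of 6 6 rot] by (simp add: o_def)

lemma rot_12_mult: "(rot ^^ (12 * n)) z = z"
  by (induction n) (simp_all add: funpow_add rot_12 del: funpow.simps)

lemma rot_mod: "(rot ^^ (n mod 12)) z = (rot ^^ n) z"
proof -
  have "(rot ^^ n) z = (rot ^^ (n mod 12 + 12 * (n div 12))) z" by simp
  also have "\<dots> = (rot ^^ (n mod 12)) z" unfolding funpow_add by (simp add: rot_12_mult)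
  finally show ?thesis by simp
qed

lemma rot_mod_cong: "m mod 12 = n mod 12 \<Longrightarrow> (rot ^^ m) z = (rot ^^ n) z"
  by (metis rot_mod)

lemma e_add: "e j (z + w) = e j z + e j w"
  and e_diff: "e j (z - w) = e j z - e j w"
  and e_scale: "e j (k *\<^sub>R z) = k * e j z"
  by (simp_all add: e_def rot_pow_add rot_pow_diff rot_pow_scale)

lemma e_rot: "e j ((rot ^^ q) z) = e (j + q) z"
  by (simp add: e_def funpow_add)

lemma e_mod: "e (j mod 12) z = e j z"
  by (simp add: e_def rot_mod)

lemma e_opp: "e (j + 6) z = - e j z"
  using e_rot[of j 6 z] e_scale[of j "- 1" z] by (simp add: rot_6)

lemma e_values:
  "e 0 (x, y) = x" "e 1 (x, y) = sqrt 3 * x + y" "e (Suc 0) (x, y) = sqrt 3 * x + y"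
  "e 2 (x, y) = 2 * x + sqrt 3 * y" "e 3 (x, y) = sqrt 3 * x + 2 * y"
  "e 4 (x, y) = x + sqrt 3 * y" "e 5 (x, y) = y"
  "e 6 (x, y) = - x" "e 7 (x, y) = - (sqrt 3 * x + y)"
  "e 8 (x, y) = - (2 * x + sqrt 3 * y)" "e 9 (x, y) = - (sqrt 3 * x + 2 * y)"
  "e 10 (x, y) = - (x + sqrt 3 * y)" "e 11 (x, y) = - y"
  by (simp_all add: e_def rot_def numeral_eq_Suc algebra_simps)

text \<open>
Translations and points with coordinates in \<open>(1/6) \<int>[sqrt 3]\<close>: the vector \<open>Vec x x' y y'\<close> stands for
\<open>((x + x' * sqrt 3) / 6, (y + y' * sqrt 3) / 6)\<close>. The denominators 2 and 3 come from the
sines in the intersection of two sides of a cell.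
\<close>

datatype vec = Vec int int int int

primrec vr :: "vec \<Rightarrow> real \<times> real" where
  "vr (Vec x x' y y') = (zr x x' / 6, zr y y' / 6)"

primrec rotv :: "vec \<Rightarrow> vec" where
  "rotv (Vec x x' y y') = Vec (3 * x' + y) (x + y') (- x) (- x')"

primrec addv :: "vec \<Rightarrow> vec \<Rightarrow> vec" where
  "addv (Vec x x' y y') w = (case w of Vec u u' v v' \<Rightarrow> Vec (x + u) (x' + u') (y + v) (y' + v'))"

primrec fstv :: "vec \<Rightarrow> int \<times> int" where
  "fstv (Vec x x' y y') = (x, x')"

definition turnv :: "nat \<Rightarrow> vec \<Rightarrow> vec" where
  "turnv q t = (rotv ^^ q) t"

definition ev :: "nat \<Rightarrow> vec \<Rightarrow> int \<times> int" where
  "ev j t = fstv (turnv j t)"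

fun zr2 :: "int \<times> int \<Rightarrow> real" where
  "zr2 (a, b) = zr a b"

lemma vr_rotv: "vr (rotv t) = rot (vr t)"
  by (cases t) (simp add: rot_def zr_def field_simps)

lemma vr_turnv: "vr (turnv q t) = (rot ^^ q) (vr t)"
  unfolding turnv_def by (induction q) (simp_all add: vr_rotv)

lemma vr_addv: "vr (addv s t) = vr s + vr t"
  by (cases s; cases t) (simp add: zr_add add_divide_distrib)

lemma vr_zero [simp]: "vr (Vec 0 0 0 0) = 0"
  by (simp add: zr_zero zero_prod_def)

declare vr.simps [simp del]

lemma zr2_ev: "zr2 (ev j t) = 6 * e j (vr t)"
proof -
  have "zr2 (fstv u) = 6 * fst (vr u)" for u by (cases u) (simp add: vr.simps)
  then show ?thesis by (simp add: ev_def e_def vr_turnv)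
qed

section \<open>Cells\<close>

text \<open>
A lower bound \<open>a + b * sqrt 3\<close> for six times a functional; the flag says whether it is strict.
\<close>

datatype bound = B int int bool

primrec above :: "bound \<Rightarrow> real \<Rightarrow> bool" where
  "above (B a b s) u = (if s then zr a b < u else zr a b \<le> u)"

primrec opp :: "bound \<Rightarrow> bound" where
  "opp (B a b s) = B (- a) (- b) (\<not> s)"

text \<open>
Negating a half-plane gives the complementary half-plane, with the other kind of boundary. A cut of
a cell therefore has exactly two parts, and no boundary point is lost or counted twice.
\<close>

lemma above_opp: "above (opp b) (- u) \<longleftrightarrow> \<not> above b u"
  by (cases b) (auto simp: zr_minus)

text \<open>
One lower bound for each of the twelve directions. An upper bound is a lower bound for the
opposite direction. Since each bound may be strict or not, open, half-open and degenerate polygons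
are all represented in the same way.
\<close>

datatype cell =
  Cell bound bound bound bound bound bound bound bound bound bound bound bound

primrec lows :: "cell \<Rightarrow> bound list" where
  "lows (Cell b0 b1 b2 b3 b4 b5 b6 b7 b8 b9 b10 b11) = [b0, b1, b2, b3, b4, b5, b6, b7, b8, b9, b10, b11]"

definition low :: "cell \<Rightarrow> nat \<Rightarrow> bound" where
  "low c j = lows c ! (j mod 12)"

text \<open>
A cell is kept together with a translation, so that moving it by a rotation and a translation
only permutes its bounds and changes one vector.
\<close>

definition region :: "cell \<Rightarrow> vec \<Rightarrow> (real \<times> real) set" where
  "region c t = {z. \<forall>j. above (low c j) (6 * e j (z - vr t))}"

abbreviation cset :: "cell \<Rightarrow> (real \<times> real) set" where
  "cset c \<equiv> region c (Vec 0 0 0 0)"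

lemma region_iff: "z \<in> region c t \<longleftrightarrow> (\<forall>j<12. above (low c j) (6 * e j (z - vr t)))"
proof -
  have "(\<forall>j. above (low c j) (6 * e j w)) \<longleftrightarrow> (\<forall>j<12. above (low c j) (6 * e j w))" (is "?l = ?r") for w
  proof
    assume r: ?r
    show ?l
    proof
      fix j
      have "above (low c (j mod 12)) (6 * e (j mod 12) w)" using r by simp
      then show "above (low c j) (6 * e j w)" by (simp add: low_def e_mod)
    qed
  qed simp
  then show ?thesis by (simp add: region_def)
qed

lemma all_less_12: "(\<forall>j<12. P j) \<longleftrightarrow> P 0 \<and> P (Suc 0) \<and> P 2 \<and> P 3 \<and> P 4 \<and> P 5 \<and> P 6 \<and> P 7 \<and> P 8 \<and> P 9 \<and> P 10 \<and> P (11 :: nat)"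
  by (simp add: numeral_eq_Suc All_less_Suc) blast

primrec turn1 :: "cell \<Rightarrow> cell" where
  "turn1 (Cell b0 b1 b2 b3 b4 b5 b6 b7 b8 b9 b10 b11) = Cell b1 b2 b3 b4 b5 b6 b7 b8 b9 b10 b11 b0"

definition turn :: "nat \<Rightarrow> cell \<Rightarrow> cell" where
  "turn q c = (turn1 ^^ q) c"

lemma low_simps:
  "low (Cell b0 b1 b2 b3 b4 b5 b6 b7 b8 b9 b10 b11) 0 = b0"
  "low (Cell b0 b1 b2 b3 b4 b5 b6 b7 b8 b9 b10 b11) (Suc 0) = b1"
  "low (Cell b0 b1 b2 b3 b4 b5 b6 b7 b8 b9 b10 b11) (Suc (Suc 0)) = b2"
  "low (Cell b0 b1 b2 b3 b4 b5 b6 b7 b8 b9 b10 b11) 1 = b1"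
  "low (Cell b0 b1 b2 b3 b4 b5 b6 b7 b8 b9 b10 b11) 2 = b2"
  "low (Cell b0 b1 b2 b3 b4 b5 b6 b7 b8 b9 b10 b11) 3 = b3"
  "low (Cell b0 b1 b2 b3 b4 b5 b6 b7 b8 b9 b10 b11) 4 = b4"
  "low (Cell b0 b1 b2 b3 b4 b5 b6 b7 b8 b9 b10 b11) 5 = b5"
  "low (Cell b0 b1 b2 b3 b4 b5 b6 b7 b8 b9 b10 b11) 6 = b6"
  "low (Cell b0 b1 b2 b3 b4 b5 b6 b7 b8 b9 b10 b11) 7 = b7"
  "low (Cell b0 b1 b2 b3 b4 b5 b6 b7 b8 b9 b10 b11) 8 = b8"
  "low (Cell b0 b1 b2 b3 b4 b5 b6 b7 b8 b9 b10 b11) 9 = b9"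
  "low (Cell b0 b1 b2 b3 b4 b5 b6 b7 b8 b9 b10 b11) 10 = b10"
  "low (Cell b0 b1 b2 b3 b4 b5 b6 b7 b8 b9 b10 b11) 11 = b11"
  "low (Cell b0 b1 b2 b3 b4 b5 b6 b7 b8 b9 b10 b11) 12 = b0"
  "low (Cell b0 b1 b2 b3 b4 b5 b6 b7 b8 b9 b10 b11) 13 = b1"
  "low (Cell b0 b1 b2 b3 b4 b5 b6 b7 b8 b9 b10 b11) 14 = b2"
  "low (Cell b0 b1 b2 b3 b4 b5 b6 b7 b8 b9 b10 b11) 15 = b3"
  "low (Cell b0 b1 b2 b3 b4 b5 b6 b7 b8 b9 b10 b11) 16 = b4"
  "low (Cell b0 b1 b2 b3 b4 b5 b6 b7 b8 b9 b10 b11) 17 = b5"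
  by (simp_all add: low_def)

lemma low_mod: "low c (j mod 12) = low c j"
  by (simp add: low_def)

lemma low_turn1: "low (turn1 c) j = low c (j + 1)"
proof -
  have "\<forall>j<12. low (turn1 c) j = low c (j + 1)"
    unfolding all_less_12 by (cases c) (simp add: low_simps)
  then have "low (turn1 c) (j mod 12) = low c (j mod 12 + 1)" by simp
  then show ?thesis by (metis low_mod mod_add_left_eq)
qed

lemma low_turn: "low (turn q c) j = low c (j + q)"
  unfolding turn_def by (induction q arbitrary: j) (simp_all add: low_turn1)

lemma region_turn:
  assumes "z \<in> region c t"
  shows "(rot ^^ q) z + vr s \<in> region (turn q c) (addv (turnv q t) s)"
proof -
  have "(rot ^^ q) z + vr s - vr (addv (turnv q t) s) = (rot ^^ q) (z - vr t)"
    by (simp add: vr_addv vr_turnv rot_pow_diff)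
  then show ?thesis using assms by (simp add: region_def low_turn e_rot)
qed

primrec shift :: "bound \<Rightarrow> int \<times> int \<Rightarrow> bound" where
  "shift (B a b s) p = (case p of (u, v) \<Rightarrow> B (a + u) (b + v) s)"

lemma above_shift: "above (shift b p) u \<longleftrightarrow> above b (u - zr2 p)"
  by (cases b; cases p) (auto simp: zr_add)

primrec settle :: "cell \<Rightarrow> vec \<Rightarrow> cell" where
  "settle (Cell b0 b1 b2 b3 b4 b5 b6 b7 b8 b9 b10 b11) t = Cell (shift b0 (ev 0 t)) (shift b1 (ev 1 t)) (shift b2 (ev 2 t)) (shift b3 (ev 3 t)) (shift b4 (ev 4 t)) (shift b5 (ev 5 t)) (shift b6 (ev 6 t)) (shift b7 (ev 7 t)) (shift b8 (ev 8 t)) (shift b9 (ev 9 t)) (shift b10 (ev 10 t)) (shift b11 (ev 11 t))"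

lemma region_settle: "cset (settle c t) = region c t"
proof -
  have "low (settle c t) j = shift (low c j) (ev j t)" if "j < 12" for j
  proof -
    have "\<forall>j<12. low (settle c t) j = shift (low c j) (ev j t)"
      unfolding all_less_12 by (cases c) (simp add: low_simps)
    then show ?thesis using that by simp
  qed
  then show ?thesis
    by (auto simp: region_iff above_shift zr2_ev e_diff algebra_simps)
qed

section \<open>Sharpening a cell\<close>

definition mul_sine :: "nat \<Rightarrow> int \<times> int \<Rightarrow> int \<times> int" where
  "mul_sine d p = (case p of (a, b) \<Rightarrow>
     if d = 1 \<or> d = 5 then (a, b) else if d = 3 then (2 * a, 2 * b) else (3 * b, a))"

text \<open>
Division that fails if the quotient has a larger denominator. A failure only means that a bound is
not improved, which is harmless for soundness.
\<close>

definition div_sine :: "nat \<Rightarrow> int \<times> int \<Rightarrow> (int \<times> int) option" where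
  "div_sine d p = (case p of (a, b) \<Rightarrow>
     if d = 5 then Some (a, b)
     else if d = 3 then
       if a mod 2 = 0 then if b mod 2 = 0 then Some (a div 2, b div 2) else None else None
     else if a mod 3 = 0 then Some (b, a div 3) else None)"

text \<open>
Twice the sine of \<open>30 * d\<close> degrees, for \<open>1 \<le> d \<le> 5\<close>.
\<close>

definition sine2 :: "nat \<Rightarrow> real" where
  "sine2 d = (if d = 1 \<or> d = 5 then 1 else if d = 3 then 2 else sqrt 3)"

lemma sine2_pos: "0 < sine2 d" by (simp add: sine2_def)

lemma zr2_mul_sine: "zr2 (mul_sine d p) = sine2 d * zr2 p"
  by (cases p) (auto simp: mul_sine_def sine2_def zr_def algebra_simps)

lemma zr2_div_sine: "d \<in> {2..5} \<Longrightarrow> div_sine d p = Some r \<Longrightarrow> sine2 d * zr2 r = zr2 p"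
  by (cases p) (auto simp: div_sine_def sine2_def zr_def algebra_simps split: if_splits elim!: dvdE
      simp flip: dvd_eq_mod_eq_0)

text \<open>
Of three of the normals within an angle of less than 180 degrees, the middle one is a nonnegative
combination of the outer ones. Hence lower bounds in two directions imply one in each direction
between them, namely the best bound that the corner between these two sides allows.
\<close>

lemma sine_rule:
  assumes "1 \<le> d" "1 \<le> d'" "d + d' \<le> 5"
  shows "sine2 (d + d') * e (i + d) z = sine2 d' * e i z + sine2 d * e (i + d + d') z"
proof -
  obtain x y where w: "(rot ^^ i) z = (x, y)" by fastforce
  have E: "e (i + k) z = e k (x, y)" for k using e_rot[of k i z] w by (simp add: add.commute)
  from assms consider "d = 1" "d' \<in> {1,2,3,4}" | "d = 2" "d' \<in> {1,2,3}" | "d = 3" "d' \<in> {1,2}" | "d = 4" "d' = 1"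
    by fastforce
  then have "sine2 (d + d') * e d (x, y) = sine2 d' * e 0 (x, y) + sine2 d * e (d + d') (x, y)"
    by cases (auto simp: sine2_def e_values algebra_simps simp flip: numeral_2_eq_2 numeral_3_eq_3)
  then show ?thesis using E[of d] E[of 0] E[of "d + d'"] by (simp add: add.assoc)
qed

definition ztest :: "bool \<Rightarrow> int \<Rightarrow> int \<Rightarrow> bool" where
  "ztest s x y = (if x = 0 then if y = 0 then s else 0 < y else zpos x y)"

lemma ztest_imp: "ztest s x y \<Longrightarrow> 0 < zr x y \<or> s \<and> zr x y = 0"
  by (auto simp: ztest_def zpos_iff zr_def split: if_splits)

fun meets :: "bound \<Rightarrow> int \<times> int \<Rightarrow> bound \<Rightarrow> bool" where
  "meets (B p q s) (u, v) (B a b s') = ztest (if s then True else \<not> s') (p + u - a) (q + v - b)"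

fun avoids :: "bound \<Rightarrow> int \<times> int \<Rightarrow> bound \<Rightarrow> bool" where
  "avoids (B p q s) (u, v) (B a b s') = ztest (if s then True else s') (a + p - u) (b + q - v)"

lemma meets_imp: "meets b0 p b \<Longrightarrow> above b0 (w - zr2 p) \<Longrightarrow> above b w"
  by (cases b0; cases b; cases p) (auto dest!: ztest_imp simp: zr_add zr_diff split: if_splits)

lemma avoids_imp: "avoids b0 p b \<Longrightarrow> above b0 (- (w - zr2 p)) \<Longrightarrow> \<not> above b w"
  by (cases b0; cases b; cases p) (auto dest!: ztest_imp simp: zr_add zr_diff split: if_splits)

fun sharpen :: "nat \<Rightarrow> nat \<Rightarrow> bound \<Rightarrow> bound \<Rightarrow> bound \<Rightarrow> bound" where
  "sharpen d d' (B pa pb ps) (B qa qb qs) b =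
     (case mul_sine d' (pa, pb) of (u, v) \<Rightarrow> case mul_sine d (qa, qb) of (u', v') \<Rightarrow>
       case div_sine (d + d') (u + u', v + v') of None \<Rightarrow> b
       | Some (x, y) \<Rightarrow> if meets b (0, 0) (B x y (ps \<or> qs)) then b else B x y (ps \<or> qs))"

lemma above_sharpen:
  assumes d: "1 \<le> d" "1 \<le> d'" "d + d' \<le> 5"
    and p: "above p (6 * e i z)" and q: "above q (6 * e (i + d + d') z)" and b: "above b (6 * e (i + d) z)"
  shows "above (sharpen d d' p q b) (6 * e (i + d) z)"
proof -
  obtain pa pb ps where pd: "p = B pa pb ps" by (cases p)
  obtain qa qb qs where qd: "q = B qa qb qs" by (cases q)
  obtain u v where uv: "mul_sine d' (pa, pb) = (u, v)" by fastforce
  obtain u' v' where uv': "mul_sine d (qa, qb) = (u', v')" by fastforce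
  show ?thesis
  proof (cases "div_sine (d + d') (u + u', v + v')")
    case None
    then show ?thesis using b by (simp add: pd qd uv uv')
  next
    case (Some r)
    obtain x y where r: "r = (x, y)" by fastforce
    have "sine2 (d + d') * zr x y = zr u v + zr u' v'"
      using zr2_div_sine[of "d + d'" _ r] Some d by (simp add: r zr_add)
    also have "\<dots> = sine2 d' * zr pa pb + sine2 d * zr qa qb"
      using zr2_mul_sine[of d' "(pa, pb)"] zr2_mul_sine[of d "(qa, qb)"] by (simp add: uv uv')
    finally have low: "sine2 (d + d') * zr x y = sine2 d' * zr pa pb + sine2 d * zr qa qb" .
    have high: "sine2 (d + d') * (6 * e (i + d) z) = sine2 d' * (6 * e i z) + sine2 d * (6 * e (i + d + d') z)"
      using sine_rule[OF d, of i z] by (simp add: algebra_simps)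
    have P: "sine2 d' * zr pa pb \<le> sine2 d' * (6 * e i z)" "ps \<Longrightarrow> sine2 d' * zr pa pb < sine2 d' * (6 * e i z)"
      using p sine2_pos[of d'] by (auto simp: pd split: if_splits)
    have Q: "sine2 d * zr qa qb \<le> sine2 d * (6 * e (i + d + d') z)"
      "qs \<Longrightarrow> sine2 d * zr qa qb < sine2 d * (6 * e (i + d + d') z)"
      using q sine2_pos[of d] by (auto simp: qd split: if_splits)
    have "sine2 (d + d') * zr x y \<le> sine2 (d + d') * (6 * e (i + d) z)"
      "ps \<or> qs \<Longrightarrow> sine2 (d + d') * zr x y < sine2 (d + d') * (6 * e (i + d) z)"
      unfolding low high using P Q by linarith+
    then have "above (B x y (ps \<or> qs)) (6 * e (i + d) z)"
      using sine2_pos[of "d + d'"] by simp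
    then show ?thesis using b Some by (simp add: pd qd uv uv' r)
  qed
qed

text \<open>
After a cut in direction 0, the new corners of a cell lie on the new side. It is therefore enough to
combine the new bound with each of the old bounds in the ten directions at an angle of less than
180 degrees to it. The bounds of a cell stay optimal in this way, so that equal polygons become
equal cells.
\<close>

primrec refine0 :: "bound \<Rightarrow> cell \<Rightarrow> cell" where
  "refine0 b (Cell b0 b1 b2 b3 b4 b5 b6 b7 b8 b9 b10 b11) = Cell b
     (sharpen 1 1 b b2 (sharpen 1 2 b b3 (sharpen 1 3 b b4 (sharpen 1 4 b b5 b1))))
     (sharpen 2 1 b b3 (sharpen 2 2 b b4 (sharpen 2 3 b b5 b2)))
     (sharpen 3 1 b b4 (sharpen 3 2 b b5 b3))
     (sharpen 4 1 b b5 b4)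
     b5 b6 b7
     (sharpen 1 4 b7 b b8)
     (sharpen 1 3 b8 b (sharpen 2 3 b7 b b9))
     (sharpen 1 2 b9 b (sharpen 2 2 b8 b (sharpen 3 2 b7 b b10)))
     (sharpen 1 1 b10 b (sharpen 2 1 b9 b (sharpen 3 1 b8 b (sharpen 4 1 b7 b b11))))"

lemma refine0:
  assumes z: "z \<in> cset c" and b: "above b (6 * e 0 z)"
  shows "z \<in> cset (refine0 b c)"
proof -
  obtain b0 b1 b2 b3 b4 b5 b6 b7 b8 b9 b10 b11 where c: "c = Cell b0 b1 b2 b3 b4 b5 b6 b7 b8 b9 b10 b11" by (cases c)
  have b': "above b (6 * e 12 z)" using b e_mod[of 12 z] by simp
  have up: "above (sharpen d d' b q r) (6 * e k z)"
    if "above q (6 * e l z)" "above r (6 * e k z)" "k = d \<and> l = d + d' \<and> 1 \<le> d \<and> 1 \<le> d' \<and> d + d' \<le> 5"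
    for d d' q r k l
    using above_sharpen[of d d' b 0 z q r] b that by simp
  have down: "above (sharpen d d' p b r) (6 * e k z)"
    if "above p (6 * e i z)" "above r (6 * e k z)" "k = i + d \<and> 12 = i + d + d' \<and> 1 \<le> d \<and> 1 \<le> d' \<and> d + d' \<le> 5"
    for d d' p r i k
    using above_sharpen[of d d' p i z b r] b' that by simp
  have old: "above b0 (6 * e 0 z)" "above b1 (6 * e (Suc 0) z)" "above b2 (6 * e 2 z)" "above b3 (6 * e 3 z)"
    "above b4 (6 * e 4 z)" "above b5 (6 * e 5 z)" "above b6 (6 * e 6 z)" "above b7 (6 * e 7 z)"
    "above b8 (6 * e 8 z)" "above b9 (6 * e 9 z)" "above b10 (6 * e 10 z)" "above b11 (6 * e 11 z)"
    using z unfolding region_iff all_less_12 by (simp_all add: c low_simps)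
  show ?thesis
    unfolding region_iff all_less_12 c refine0.simps low_simps vr_zero diff_zero
    by (intro conjI) (rule b old | rule up[OF old(3)] up[OF old(4)] up[OF old(5)] up[OF old(6)]
       down[OF old(8)] down[OF old(9)] down[OF old(10)] down[OF old(11)] | simp)+
qed

definition refine :: "nat \<Rightarrow> bound \<Rightarrow> cell \<Rightarrow> cell" where
  "refine j b c = turn (12 - j mod 12) (refine0 b (turn (j mod 12) c))"

lemma refine:
  assumes z: "z \<in> cset c" and b: "above b (6 * e j z)"
  shows "z \<in> cset (refine j b c)"
proof -
  have tz: "turnv k (Vec 0 0 0 0) = Vec 0 0 0 0" for k
    by (induction k) (simp_all add: turnv_def)
  have tr: "(rot ^^ k) w \<in> cset (turn k c')" if "w \<in> cset c'" for k w c'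
    using region_turn[OF that, of k "Vec 0 0 0 0"] by (simp add: tz)
  have "(rot ^^ (j mod 12)) z \<in> cset (refine0 b (turn (j mod 12) c))"
    using b by (intro refine0 tr z) (simp add: e_rot e_mod)
  from tr[OF this, of "12 - j mod 12"]
  have "(rot ^^ (12 - j mod 12 + j mod 12)) z \<in> cset (refine j b c)"
    by (simp only: refine_def funpow_add o_apply)
  moreover have "12 - j mod 12 + j mod 12 = 12"
    using mod_less_divisor[of 12 j] by linarith
  ultimately show ?thesis by (simp add: rot_12)
qed

section \<open>Decision trees and the maps they describe\<close>

datatype act = Turn nat vec | Stop

text \<open>
A decision tree describes a piecewise isometry: \<open>Ask j b y n\<close> compares the functional \<open>e j\<close>
with a bound, and the leaf \<open>Turn q s\<close> stands for \<open>rot ^^ q\<close> followed by the translation \<open>s\<close>. The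
leaf \<open>Stop\<close> marks a target region.
\<close>

datatype tree = Do act | Ask nat bound tree tree
datatype outcome = Act act | Split nat bound

primrec select :: "tree \<Rightarrow> real \<times> real \<Rightarrow> act" where
  "select (Do a) z = a"
| "select (Ask j b y n) z = (if above b (6 * e j z) then select y z else select n z)"

text \<open>
The same decision for a whole cell. If the cell meets both sides of a comparison, the comparison is
reported as a place to cut.
\<close>

primrec decide :: "tree \<Rightarrow> cell \<Rightarrow> vec \<Rightarrow> outcome" where
  "decide (Do a) c t = Act a"
| "decide (Ask j b y n) c t =
    (if meets (low c j) (ev j t) b then decide y c t
     else if avoids (low c (j + 6)) (ev j t) b then decide n c t
     else Split j b)"

lemma decide_select:
  assumes "z \<in> region c t"
  shows "decide U c t = Act a \<Longrightarrow> select U z = a"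
proof (induction U)
  case (Ask j b y n)
  have lo: "above (low c j) (6 * e j z - zr2 (ev j t))"
    and hi: "above (low c (j + 6)) (- (6 * e j z - zr2 (ev j t)))"
    using assms by (auto simp: region_def zr2_ev e_diff e_opp algebra_simps dest!: spec[of _ j] spec[of _ "j + 6"])
  show ?case
    using Ask meets_imp[OF _ lo, of b] avoids_imp[OF _ hi, of b] by (auto split: if_splits)
qed simp

definition step :: "tree \<Rightarrow> real \<times> real \<Rightarrow> real \<times> real" where
  "step U z = (case select U z of Turn q s \<Rightarrow> (rot ^^ q) z + vr s | Stop \<Rightarrow> z)"

text \<open>
The tree may stop where the map \<open>f\<close> goes on. In this way a target region is added to a tree
without a change of the map.
\<close>

definition follows :: "tree \<Rightarrow> (real \<times> real \<Rightarrow> real \<times> real) \<Rightarrow> bool" where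
  "follows U f \<longleftrightarrow> (\<forall>z q s. select U z = Turn q s \<longrightarrow> f z = (rot ^^ q) z + vr s)"

lemma follows_step: "follows U (step U)"
  by (simp add: follows_def step_def)

lemma decide_moves:
  assumes "follows U f" "decide U c t = Act (Turn q s)" "z \<in> region c t"
  shows "f z = (rot ^^ q) z + vr s" "f z \<in> region (turn q c) (addv (turnv q t) s)"
proof -
  show "f z = (rot ^^ q) z + vr s"
    using decide_select[OF assms(3,2)] assms(1) unfolding follows_def by blast
  then show "f z \<in> region (turn q c) (addv (turnv q t) s)"
    using region_turn[OF assms(3)] by simp
qed

section \<open>Finite orbits\<close>

definition finite_orbit :: "('a \<Rightarrow> 'a) \<Rightarrow> 'a \<Rightarrow> bool" where
  "finite_orbit f z \<longleftrightarrow> finite (range (\<lambda>i. (f ^^ i) z))"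

lemma finite_orbit_iff: "finite_orbit f z \<longleftrightarrow> (\<exists>i j. i < j \<and> (f ^^ i) z = (f ^^ j) z)"
proof
  assume "finite_orbit f z"
  then have "\<not> inj (\<lambda>i. (f ^^ i) z)"
    unfolding finite_orbit_def using finite_imageD infinite_UNIV_nat by blast
  then show "\<exists>i j. i < j \<and> (f ^^ i) z = (f ^^ j) z"
    by (metis (mono_tags, lifting) injI linorder_neqE_nat)
next
  assume "\<exists>i j. i < j \<and> (f ^^ i) z = (f ^^ j) z"
  then obtain i j where ij: "i < j" "(f ^^ i) z = (f ^^ j) z" by blast
  have "(f ^^ k) z \<in> (\<lambda>l. (f ^^ l) z) ` {..<j}" for k
  proof (induction k)
    case 0
    then show ?case using ij(1) by (intro image_eqI[of _ _ 0]) auto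
  next
    case (Suc k)
    then obtain l where l: "l < j" "(f ^^ k) z = (f ^^ l) z" by auto
    then have step: "(f ^^ Suc k) z = (f ^^ Suc l) z" by simp
    show ?case
    proof (cases "Suc l = j")
      case True
      then show ?thesis using step ij by (intro image_eqI[of _ _ i]) auto
    next
      case False
      then show ?thesis using step l by (intro image_eqI[of _ _ "Suc l"]) auto
    qed
  qed
  then show "finite_orbit f z"
    unfolding finite_orbit_def by (meson finite_imageI finite_lessThan finite_subset image_subsetI)
qed

lemma finite_orbit_funpow: "finite_orbit f ((f ^^ n) z) \<longleftrightarrow> finite_orbit f z"
proof
  assume "finite_orbit f ((f ^^ n) z)"
  then obtain i j where "i < j" "(f ^^ i) ((f ^^ n) z) = (f ^^ j) ((f ^^ n) z)" unfolding finite_orbit_iff by blast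
  then have "i + n < j + n" "(f ^^ (i + n)) z = (f ^^ (j + n)) z" by (simp_all add: funpow_add)
  then show "finite_orbit f z" unfolding finite_orbit_iff by blast
next
  assume "finite_orbit f z"
  moreover have "range (\<lambda>i. (f ^^ i) ((f ^^ n) z)) \<subseteq> range (\<lambda>i. (f ^^ i) z)"
    by (auto simp flip: funpow_add[unfolded comp_def fun_eq_iff, rule_format])
  ultimately show "finite_orbit f ((f ^^ n) z)" unfolding finite_orbit_def by (rule rev_finite_subset)
qed

text \<open>
A cell that returns to itself under one affine map with linear part \<open>rot ^^ r\<close> consists of points
with finite orbits. Twelve returns compose to a translation, because \<open>rot ^^ 12\<close> is the identity,
and a nonzero translation cannot map a bounded set into itself.
\<close>

lemma cell_return_finite_orbit:
  assumes n: "0 < n"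
    and aff: "\<And>w. w \<in> cset c \<Longrightarrow> (f ^^ n) w = (rot ^^ r) w + v"
    and ret: "\<And>w. w \<in> cset c \<Longrightarrow> (f ^^ n) w \<in> cset c"
    and z: "z \<in> cset c"
  shows "finite_orbit f z"
proof -
  define g where "g = f ^^ n"
  have g: "g w = (rot ^^ r) w + v" "g w \<in> cset c" if "w \<in> cset c" for w
    using that aff ret by (simp_all add: g_def)
  have "\<exists>u. \<forall>w\<in>cset c. (g ^^ k) w = (rot ^^ (r * k)) w + u \<and> (g ^^ k) w \<in> cset c" for k
  proof (induction k)
    case 0
    then show ?case by (intro exI[of _ 0]) simp
  next
    case (Suc k)
    then obtain u where u: "\<forall>w\<in>cset c. (g ^^ k) w = (rot ^^ (r * k)) w + u \<and> (g ^^ k) w \<in> cset c" by blast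
    have "(g ^^ Suc k) w = (rot ^^ (r * Suc k)) w + ((rot ^^ r) u + v) \<and> (g ^^ Suc k) w \<in> cset c"
      if w: "w \<in> cset c" for w
    proof -
      have k: "(g ^^ k) w \<in> cset c" "(g ^^ k) w = (rot ^^ (r * k)) w + u" using u w by blast+
      have "(g ^^ Suc k) w = (rot ^^ r) ((rot ^^ (r * k)) w + u) + v"
        using g(1)[OF k(1)] by (simp add: k(2))
      moreover have "(g ^^ Suc k) w \<in> cset c" using g(2)[OF k(1)] by simp
      ultimately show ?thesis by (simp add: rot_pow_add funpow_add)
    qed
    then show ?case by blast
  qed
  from this[of 12] obtain u where "\<forall>w\<in>cset c. (g ^^ 12) w = (rot ^^ (12 * r)) w + u \<and> (g ^^ 12) w \<in> cset c"
    by (metis mult.commute)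
  then have u: "(g ^^ 12) w = w + u" "w + u \<in> cset c" if "w \<in> cset c" for w
    using that unfolding rot_12_mult by metis+
  have it: "((g ^^ 12) ^^ k) z = z + real k *\<^sub>R u \<and> z + real k *\<^sub>R u \<in> cset c" for k
  proof (induction k)
    case (Suc k)
    have next_eq: "z + real k *\<^sub>R u + u = z + real (Suc k) *\<^sub>R u" by (simp add: algebra_simps)
    have w: "z + real k *\<^sub>R u \<in> cset c" and "((g ^^ 12) ^^ Suc k) z = (g ^^ 12) (z + real k *\<^sub>R u)"
      using Suc by simp_all
    then show ?case using u[OF w] unfolding next_eq by simp
  qed (use z in simp)
  \<comment> \<open>Otherwise a multiple of \<open>u\<close> would violate the bound of the cell in direction \<open>j + 6\<close>.\<close>
  have "e j u \<le> 0" for j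
  proof (rule ccontr)
    assume pos: "\<not> e j u \<le> 0"
    obtain a b s where B: "low c (j + 6) = B a b s" by (cases "low c (j + 6)")
    obtain k :: nat where k: "(- zr a b / 6 - e j z) / e j u < real k" using reals_Archimedean2 by blast
    have "above (low c (j + 6)) (6 * e (j + 6) (z + real k *\<^sub>R u))"
      using it[of k] by (auto simp: region_def)
    then have "zr a b \<le> - (6 * (e j z + real k * e j u))"
      by (auto simp: B e_opp e_add e_scale split: if_splits)
    then show False using k pos by (simp add: field_simps)
  qed
  from this[of 0] this[of 6] this[of 5] this[of 11] have "u = 0"
    by (cases u) (simp add: e_values zero_prod_def)
  then have "(f ^^ 0) z = (f ^^ (n * 12)) z" using u(1)[OF z] by (simp add: g_def funpow_mult)
  then show ?thesis using n unfolding finite_orbit_iff by (metis mult_pos_pos zero_less_numeral)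
qed

section \<open>Following a cell\<close>

datatype run = Loops | Halts nat | Breaks nat cell "(nat \<times> bound) option"

fun same_bound :: "bound \<Rightarrow> bound \<Rightarrow> bool" where
  "same_bound (B a b s) (B a' b' s') = (if a = a' then if b = b' then s = s' else False else False)"

fun same_cell :: "cell \<Rightarrow> cell \<Rightarrow> bool" where
  "same_cell (Cell b0 b1 b2 b3 b4 b5 b6 b7 b8 b9 b10 b11) (Cell a0 a1 a2 a3 a4 a5 a6 a7 a8 a9 a10 a11) = (if same_bound b0 a0 then (if same_bound b1 a1 then (if same_bound b2 a2 then (if same_bound b3 a3 then (if same_bound b4 a4 then (if same_bound b5 a5 then (if same_bound b6 a6 then (if same_bound b7 a7 then (if same_bound b8 a8 then (if same_bound b9 a9 then (if same_bound b10 a10 then (if same_bound b11 a11 then True else False) else False) else False) else False) else False) else False) else False) else False) else False) else False) else False) else False)"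

lemma same_cell: "same_cell c c' \<Longrightarrow> c = c'"
proof -
  have "same_bound b b' \<Longrightarrow> b = b'" for b b' by (cases b; cases b') (simp split: if_splits)
  then show "same_cell c c' \<Longrightarrow> c = c'" by (cases c; cases c') (simp split: if_splits)
qed

text \<open>
The first bounds are compared before the cell is normalised, since most comparisons fail there.
\<close>

definition same :: "cell \<Rightarrow> vec \<Rightarrow> cell \<Rightarrow> bool" where
  "same c t c0 = (if same_bound (shift (low c 0) (ev 0 t)) (low c0 0) then same_cell (settle c t) c0 else False)"

definition pass :: "(cell \<Rightarrow> vec \<Rightarrow> run) \<Rightarrow> cell \<Rightarrow> cell \<Rightarrow> vec \<Rightarrow> run" where
  "pass k c0 c t = (if same c t c0 then Loops else k c t)"

fun proceed :: "(cell \<Rightarrow> vec \<Rightarrow> run) \<Rightarrow> nat \<Rightarrow> cell \<Rightarrow> cell \<Rightarrow> vec \<Rightarrow> outcome \<Rightarrow> run" where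
  "proceed k n c0 c t (Split j b) = Breaks n (settle c t) (Some (j, b))"
| "proceed k n c0 c t (Act Stop) = Halts n"
| "proceed k n c0 c t (Act (Turn q s)) = pass k c0 (turn q c) (addv (turnv q t) s)"

text \<open>
Follows a cell until it comes back to the cell \<open>c0\<close>, reaches \<open>Stop\<close>, has to be cut, or the
number \<open>n\<close> of steps is used up. The remaining number of steps is part of the result.
\<close>

function trace :: "(cell \<Rightarrow> vec \<Rightarrow> outcome) \<Rightarrow> nat \<Rightarrow> cell \<Rightarrow> cell \<Rightarrow> vec \<Rightarrow> run" where
  "trace d n c0 c t = (if n = 0 then Breaks n (settle c t) None else
     proceed (trace d (n - 1) c0) n c0 c t (d c t))"
  by auto
termination by (relation "Wellfounded.measure (\<lambda>(d, n, c0, c, t). n)") auto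
declare trace.simps [simp del]

lemma trace_sound:
  assumes f: "follows U f"
  shows "(case trace (decide U) n c0 c t of
      Loops \<Rightarrow> \<exists>i r v. 0 < i \<and> (\<forall>z\<in>region c t. (f ^^ i) z = (rot ^^ r) z + v \<and> (f ^^ i) z \<in> cset c0)
    | Halts m \<Rightarrow> m \<le> n \<and> (\<forall>z\<in>region c t. select U ((f ^^ (n - m)) z) = Stop)
    | Breaks m c' x \<Rightarrow> m \<le> n \<and> (\<forall>z\<in>region c t. (f ^^ (n - m)) z \<in> cset c'))"
proof (induction n arbitrary: c t)
  case 0
  then show ?case by (simp add: trace.simps[of _ 0] region_settle)
next
  case (Suc n)
  show ?case
  proof (cases "decide U c t")
    case (Split j b)
    then show ?thesis by (simp add: trace.simps[of _ "Suc n"] region_settle)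
  next
    case (Act a)
    show ?thesis
    proof (cases a)
      case Stop
      then show ?thesis using Act decide_select by (simp add: trace.simps[of _ "Suc n"])
    next
      case (Turn q s)
      let ?c = "turn q c" and ?t = "addv (turnv q t) s"
      have z: "f z = (rot ^^ q) z + vr s" "f z \<in> region ?c ?t" if "z \<in> region c t" for z
        using decide_moves[OF f _ that] Act Turn by blast+
      show ?thesis
      proof (cases "same ?c ?t c0")
        case True
        then have "region ?c ?t = cset c0"
          by (metis same_def region_settle same_cell)
        then have "\<exists>i r v. 0 < i \<and> (\<forall>z\<in>region c t. (f ^^ i) z = (rot ^^ r) z + v \<and> (f ^^ i) z \<in> cset c0)"
          using z by (intro exI[of _ "Suc 0"] exI[of _ q] exI[of _ "vr s"]) simp
        then show ?thesis using True Act Turn by (simp add: trace.simps[of _ "Suc n"] pass_def)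
      next
        case False
        then have tr: "trace (decide U) (Suc n) c0 c t = trace (decide U) n c0 ?c ?t"
          using Act Turn by (simp add: trace.simps[of _ "Suc n"] pass_def)
        have sh: "(f ^^ (Suc n - m)) z = (f ^^ (n - m)) (f z)" if "m \<le> n" for m z
          using that by (simp add: Suc_diff_le funpow_Suc_right del: funpow.simps)
        show ?thesis
        proof (cases "trace (decide U) n c0 ?c ?t")
          case Loops
          with Suc.IH[of ?c ?t] obtain i r v where i: "0 < i"
            "\<forall>z\<in>region ?c ?t. (f ^^ i) z = (rot ^^ r) z + v \<and> (f ^^ i) z \<in> cset c0" by auto
          have "(f ^^ Suc i) w = (rot ^^ (r + q)) w + ((rot ^^ r) (vr s) + v) \<and> (f ^^ Suc i) w \<in> cset c0"
            if w: "w \<in> region c t" for w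
          proof -
            have eq: "(f ^^ Suc i) w = (f ^^ i) (f w)" by (simp add: funpow_Suc_right del: funpow.simps)
            have "(f ^^ i) (f w) = (rot ^^ r) (f w) + v" "(f ^^ i) (f w) \<in> cset c0"
              using i(2) z(2)[OF w] by blast+
            moreover have "(rot ^^ r) (f w) + v = (rot ^^ (r + q)) w + ((rot ^^ r) (vr s) + v)"
              by (simp add: z(1)[OF w] funpow_add rot_pow_add)
            ultimately show ?thesis unfolding eq by simp
          qed
          then have "\<exists>i r v. 0 < i \<and> (\<forall>z\<in>region c t. (f ^^ i) z = (rot ^^ r) z + v \<and> (f ^^ i) z \<in> cset c0)"
            by - (rule exI[of _ "Suc i"], rule exI[of _ "r + q"], rule exI[of _ "(rot ^^ r) (vr s) + v"],
                intro conjI ballI zero_less_Suc, blast+)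
          then show ?thesis by (simp only: tr Loops run.case)
        next
          case (Halts m)
          then show ?thesis using Suc.IH[of ?c ?t] z sh[of m] tr by (auto simp del: funpow.simps)
        next
          case (Breaks m c' x)
          then show ?thesis using Suc.IH[of ?c ?t] z sh[of m] tr by (auto simp del: funpow.simps)
        qed
      qed
    qed
  qed
qed

section \<open>Exploring a cell\<close>

fun join :: "nat \<Rightarrow> nat option \<Rightarrow> nat option \<Rightarrow> nat option" where
  "join i (Some m) (Some m') = Some (i + max m m')"
| "join i _ _ = None"

fun delay :: "nat \<Rightarrow> nat option \<Rightarrow> nat option" where
  "delay i None = None"
| "delay i (Some m) = Some (i + m)"

fun branch :: "(cell \<Rightarrow> nat option) \<Rightarrow> nat \<Rightarrow> cell \<Rightarrow> (nat \<times> bound) option \<Rightarrow> nat option \<Rightarrow> nat option" where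
  "branch ex i c x (Some m) = Some (i + m)"
| "branch ex i c None None = delay i (ex c)"
| "branch ex i c (Some (j, b)) None = join i (ex (refine j b c)) (ex (refine (j + 6) (opp b) c))"

fun resume :: "(cell \<Rightarrow> nat option) \<Rightarrow> (cell \<Rightarrow> nat option) \<Rightarrow> nat \<Rightarrow> run \<Rightarrow> nat option" where
  "resume ex L N Loops = Some 0"
| "resume ex L N (Halts n) = Some (N - n)"
| "resume ex L N (Breaks n c x) = branch ex (N - n) c x (L c)"

text \<open>
Follows a cell, cuts it where necessary, and treats the parts in the same way. The function \<open>L\<close>
gives the hitting times of cells that are already known to be good, and \<open>k\<close> bounds the depth of
the recursion. The result is a bound for the number of steps until \<open>Stop\<close>, with 0 for cells
that return. If the steps are used up, the cell starts afresh: a map that is not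
injective may lead a cell to a cycle that does not contain it.
\<close>

function explore :: "(cell \<Rightarrow> vec \<Rightarrow> outcome) \<Rightarrow> (cell \<Rightarrow> nat option) \<Rightarrow> nat \<Rightarrow> nat \<Rightarrow> cell \<Rightarrow> nat option" where
  "explore d L N k c = (if k = 0 then None else
     resume (explore d L N (k - 1)) L N (trace d N c c (Vec 0 0 0 0)))"
  by auto
termination by (relation "Wellfounded.measure (\<lambda>(d, L, N, k, c). k)") auto
declare explore.simps [simp del]

definition good :: "tree \<Rightarrow> (real \<times> real \<Rightarrow> real \<times> real) \<Rightarrow> nat \<Rightarrow> real \<times> real \<Rightarrow> bool" where
  "good U f m z \<longleftrightarrow> finite_orbit f z \<or> (\<exists>j\<le>m. select U ((f ^^ j) z) = Stop)"

lemma good_mono: "good U f m z \<Longrightarrow> m \<le> m' \<Longrightarrow> good U f m' z"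
  unfolding good_def using le_trans by blast

lemma good_funpow:
  assumes "good U f m ((f ^^ i) z)"
  shows "good U f (i + m) z"
  using assms unfolding good_def finite_orbit_funpow
proof (elim disjE exE conjE)
  fix j assume "j \<le> m" "select U ((f ^^ j) ((f ^^ i) z)) = Stop"
  then have "j + i \<le> i + m" "select U ((f ^^ (j + i)) z) = Stop" by (simp_all add: funpow_add)
  then show "finite_orbit f z \<or> (\<exists>j\<le>i + m. select U ((f ^^ j) z) = Stop)" by blast
qed simp

lemma explore_sound:
  assumes f: "follows U f"
    and L: "\<And>c m z. L c = Some m \<Longrightarrow> z \<in> cset c \<Longrightarrow> good U f m z"
  shows "explore (decide U) L N k c = Some m \<Longrightarrow> z \<in> cset c \<Longrightarrow> good U f m z"
proof (induction k arbitrary: c m z)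
  case 0
  then show ?case by (simp add: explore.simps[of _ _ _ 0])
next
  case (Suc k)
  note tr = trace_sound[OF f, where n = N and ?c0.0 = c and c = c and t = "Vec 0 0 0 0"]
  have ex: "resume (explore (decide U) L N k) L N (trace (decide U) N c c (Vec 0 0 0 0)) = Some m"
    using Suc.prems(1) by (simp add: explore.simps[of _ _ _ "Suc k"])
  show ?case
  proof (cases "trace (decide U) N c c (Vec 0 0 0 0)")
    case Loops
    then obtain i r v where "0 < i"
      "\<forall>z\<in>cset c. (f ^^ i) z = (rot ^^ r) z + v \<and> (f ^^ i) z \<in> cset c" using tr by auto
    then have "finite_orbit f z" using cell_return_finite_orbit[of i c f r v] Suc.prems(2) by blast
    then show ?thesis by (simp add: good_def)
  next
    case (Halts n)
    then show ?thesis using ex tr Suc.prems(2) by (auto simp: good_def)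
  next
    case (Breaks n c' x)
    define w where "w = (f ^^ (N - n)) z"
    have w: "w \<in> cset c'" using tr Breaks Suc.prems(2) by (simp add: w_def)
    have lift: "good U f (N - n + l) z" if "good U f l w" for l
      using that good_funpow by (simp add: w_def)
    show ?thesis
    proof (cases "L c'")
      case (Some l)
      then have "m = N - n + l" using ex Breaks by simp
      then show ?thesis using lift[OF L[OF Some w]] by simp
    next
      case None
      show ?thesis
      proof (cases x)
        case x: None
        then have "delay (N - n) (explore (decide U) L N k c') = Some m"
          using ex Breaks None by simp
        then show ?thesis
          using lift[OF Suc.IH[OF _ w]] by (cases "explore (decide U) L N k c'") simp_all
      next
        case (Some jb)
        obtain j b where jb: "jb = (j, b)" by fastforce
        let ?e1 = "explore (decide U) L N k (refine j b c')"
        let ?e2 = "explore (decide U) L N k (refine (j + 6) (opp b) c')"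
        have "join (N - n) ?e1 ?e2 = Some m" using ex Breaks None Some jb by simp
        then obtain m1 m2 where e: "?e1 = Some m1" "?e2 = Some m2" and m: "m = N - n + max m1 m2"
          by (cases ?e1; cases ?e2) auto
        have "good U f (max m1 m2) w"
        proof (cases "above b (6 * e j w)")
          case True
          then show ?thesis using Suc.IH[OF e(1) refine[OF w]] good_mono max.cobounded1 by blast
        next
          case False
          then have "above (opp b) (6 * e (j + 6) w)" using above_opp[of b "6 * e j w"] by (simp add: e_opp)
          then show ?thesis using Suc.IH[OF e(2) refine[OF w]] good_mono max.cobounded2 by blast
        qed
        then show ?thesis using lift m by blast
      qed
    qed
  qed
qed

fun search :: "nat \<Rightarrow> nat \<Rightarrow> (cell \<times> nat) list \<Rightarrow> cell \<Rightarrow> nat option" where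
  "search i j [] c = None"
| "search i j (x # xs) c =
    (if i = j then None else if same_cell (fst x) c then Some (snd x) else search i (j + 1) xs c)"

lemma searchD: "search (j + n) j xs c = Some m \<Longrightarrow> \<exists>k<n. k < length xs \<and> xs ! k = (c, m)"
proof (induction xs arbitrary: j n)
  case (Cons x xs)
  show ?case
  proof (cases n)
    case (Suc n')
    show ?thesis
    proof (cases "same_cell (fst x) c")
      case True
      then show ?thesis using Cons.prems Suc same_cell by (intro exI[of _ 0]) (auto simp: prod_eq_iff)
    next
      case False
      then have "search (j + 1 + n') (j + 1) xs c = Some m" using Cons.prems Suc by simp
      from Cons.IH[OF this] obtain k where "k < n'" "k < length xs" "xs ! k = (c, m)" by blast
      then show ?thesis using Suc by (intro exI[of _ "Suc k"]) simp
    qed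
  qed (use Cons.prems in simp)
qed simp

text \<open>
Cells that occur many times are explored once. The list is ordered so that the exploration of an
entry refers to earlier entries only, and the induction is on the position in the list.
\<close>

lemma explore_list_sound:
  assumes f: "follows U f"
    and xs: "\<And>i. i < length xs \<Longrightarrow>
      \<exists>m\<le>snd (xs ! i). explore (decide U) (search i 0 xs) N k (fst (xs ! i)) = Some m"
  shows "search i 0 xs c = Some m \<Longrightarrow> z \<in> cset c \<Longrightarrow> good U f m z"
proof (induction i arbitrary: c m z rule: less_induct)
  case (less i)
  obtain j where j: "j < i" "j < length xs" "xs ! j = (c, m)"
    using searchD[of 0 i xs c m] less.prems(1) by auto
  obtain m' where m': "m' \<le> m" "explore (decide U) (search j 0 xs) N k c = Some m'"
    using xs[OF j(2)] j(3) by auto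
  have "good U f m' z"
    using explore_sound[OF f _ m'(2) less.prems(2)] less.IH[OF j(1)] by blast
  then show ?case using good_mono m'(1) by blast
qed

section \<open>Renormalisation of a map by a similarity\<close>

primrec pieces :: "tree \<Rightarrow> cell \<Rightarrow> (cell \<times> act) list" where
  "pieces (Do a) c = [(c, a)]"
| "pieces (Ask j b y n) c = pieces y (refine j b c) @ pieces n (refine (j + 6) (opp b) c)"

lemma pieces_cover: "z \<in> cset c \<Longrightarrow> \<exists>c'. (c', select U z) \<in> set (pieces U c) \<and> z \<in> cset c'"
proof (induction U arbitrary: c)
  case (Ask j b y n)
  show ?case
  proof (cases "above b (6 * e j z)")
    case True
    then show ?thesis using Ask.IH(1)[OF refine[OF Ask.prems True]] by auto
  next
    case False
    then have "above (opp b) (6 * e (j + 6) z)" using above_opp[of b "6 * e j z"] by (simp add: e_opp)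
    then show ?thesis using Ask.IH(2)[OF refine[OF Ask.prems]] False by fastforce
  qed
qed auto

definition mulz :: "int \<times> int \<Rightarrow> int \<Rightarrow> int \<Rightarrow> int \<times> int" where
  "mulz l a b = (fst l * a + 3 * (snd l * b), fst l * b + snd l * a)"

lemma zr2_mulz: "zr2 (mulz l a b) = zr2 l * zr a b"
  by (cases l) (simp add: mulz_def zr_mult)

primrec scaleb :: "int \<times> int \<Rightarrow> bound \<Rightarrow> bound" where
  "scaleb l (B a b s) = B (fst (mulz l a b)) (snd (mulz l a b)) s"

primrec scale :: "int \<times> int \<Rightarrow> cell \<Rightarrow> cell" where
  "scale l (Cell b0 b1 b2 b3 b4 b5 b6 b7 b8 b9 b10 b11) = Cell (scaleb l b0) (scaleb l b1) (scaleb l b2) (scaleb l b3) (scaleb l b4) (scaleb l b5) (scaleb l b6) (scaleb l b7) (scaleb l b8) (scaleb l b9) (scaleb l b10) (scaleb l b11)"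

primrec scalev :: "int \<times> int \<Rightarrow> vec \<Rightarrow> vec" where
  "scalev l (Vec x x' y y') = Vec (fst (mulz l x x')) (snd (mulz l x x')) (fst (mulz l y y')) (snd (mulz l y y'))"

lemma above_scaleb: "0 < zr2 l \<Longrightarrow> above b u \<Longrightarrow> above (scaleb l b) (zr2 l * u)"
  using zr2_mulz[of l] by (cases b) (auto simp flip: zr2.simps split: if_splits)

lemma vr_scalev: "vr (scalev l v) = zr2 l *\<^sub>R vr v"
  using zr2_mulz[of l] by (cases v) (auto simp: vr.simps simp flip: zr2.simps)

lemma cset_scale:
  assumes "0 < zr2 l" "z \<in> cset c"
  shows "zr2 l *\<^sub>R z \<in> cset (scale l c)"
proof -
  have low: "low (scale l c) j = scaleb l (low c j)" if "j < 12" for j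
  proof -
    have "\<forall>j<12. low (scale l c) j = scaleb l (low c j)"
      unfolding all_less_12 by (cases c) (simp add: low_simps)
    then show ?thesis using that by simp
  qed
  have sc: "6 * e j (zr2 l *\<^sub>R z) = zr2 l * (6 * e j z)" for j by (simp add: e_scale)
  show ?thesis
    using assms unfolding region_iff vr_zero diff_zero sc by (auto simp: low intro!: above_scaleb)
qed

text \<open>
A similarity with ratio \<open>zr2 l\<close> that also turns by \<open>30 * s\<close> degrees.
\<close>

definition sim :: "vec \<Rightarrow> nat \<Rightarrow> int \<times> int \<Rightarrow> real \<times> real \<Rightarrow> real \<times> real" where
  "sim z0 s l w = vr z0 + (rot ^^ s) (zr2 l *\<^sub>R w)"

lemma region_shift: "z \<in> region c t \<longleftrightarrow> z - vr t \<in> cset c"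
  by (simp add: region_def)

primrec negv :: "vec \<Rightarrow> vec" where
  "negv (Vec x x' y y') = Vec (- x) (- x') (- y) (- y')"

lemma vr_negv: "vr (negv t) = - vr t"
  by (cases t) (simp add: vr.simps zr_minus)

text \<open>
Cuts a cell without changing the translation that comes with it, since this translation is the
image of a marked point and has to be preserved.
\<close>

definition part :: "nat \<Rightarrow> bound \<Rightarrow> cell \<Rightarrow> vec \<Rightarrow> cell" where
  "part j b c t = settle (refine j b (settle c t)) (negv t)"

lemma part:
  assumes "z \<in> region c t" "above b (6 * e j z)"
  shows "z \<in> region (part j b c t) t"
proof -
  have "z \<in> cset (refine j b (settle c t))"
    using assms by (intro refine) (simp_all add: region_settle)
  then show ?thesis
    unfolding part_def region_shift[of z _ t] region_settle region_shift[of _ _ "negv t"] by (simp add: vr_negv)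
qed

fun agree :: "(nat \<times> vec) option \<Rightarrow> (nat \<times> vec) option \<Rightarrow> (nat \<times> vec) option" where
  "agree (Some (r, t)) (Some (r', t')) = (if r = r' then if t = t' then Some (r, t) else None else None)"
| "agree x y = None"

lemma agree_Some: "agree x y = Some p \<longleftrightarrow> x = Some p \<and> y = Some p"
  by (cases "(x, y)" rule: agree.cases) auto

fun march_on :: "(nat \<Rightarrow> nat \<Rightarrow> cell \<Rightarrow> vec \<Rightarrow> (nat \<times> vec) option) \<Rightarrow>
    nat \<Rightarrow> nat \<Rightarrow> cell \<Rightarrow> vec \<Rightarrow> outcome \<Rightarrow> (nat \<times> vec) option" where
  "march_on k n r c t (Act (Turn q s)) = k (n - 1) ((r + q) mod 12) (turn q c) (addv (turnv q t) s)"
| "march_on k n r c t (Act Stop) = None"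
| "march_on k n r c t (Split j b) = agree (k n r (part j b c t) t) (k n r (part (j + 6) (opp b) c t) t)"

text \<open>
Applies \<open>n\<close> steps to a cell and keeps track of the affine map that they compose to, in the form of its
rotation and of the image of the point at which the marked translation starts. A cell may be cut on
the way, but the parts must arrive under the same affine map: a cell that is torn apart by
the fractional part is glued together again later.
\<close>

function march :: "(cell \<Rightarrow> vec \<Rightarrow> outcome) \<Rightarrow> nat \<Rightarrow> nat \<Rightarrow> nat \<Rightarrow> cell \<Rightarrow> vec \<Rightarrow> (nat \<times> vec) option" where
  "march d N n r c t = (if n = 0 then Some (r, t) else if N = 0 then None
     else march_on (march d (N - 1)) n r c t (d c t))"
  by auto
termination by (relation "Wellfounded.measure (\<lambda>(d, N, n, r, c, t). N)") auto
declare march.simps [simp del]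

lemma march_sound:
  assumes f: "follows U f"
  shows "march (decide U) N n r c t = Some (r', t') \<Longrightarrow> r < 12 \<Longrightarrow> z \<in> region c t \<Longrightarrow>
    \<exists>k. (r + k) mod 12 = r' \<and> (f ^^ n) z = (rot ^^ k) (z - vr t) + vr t'"
proof (induction N arbitrary: n r c t z)
  case 0
  then have "r = r'" "t = t'" "n = 0" by (auto simp: march.simps[of _ 0] split: if_splits)
  then show ?case using 0 by (intro exI[of _ 0]) simp
next
  case (Suc N)
  show ?case
  proof (cases "n = 0")
    case True
    then show ?thesis using Suc.prems by (intro exI[of _ 0]) (simp add: march.simps[of _ "Suc N"])
  next
    case False
    then have m: "march_on (march (decide U) N) n r c t (decide U c t) = Some (r', t')"
      using Suc.prems(1) by (simp add: march.simps[of _ "Suc N"])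
    show ?thesis
    proof (cases "decide U c t")
      case (Act a)
      show ?thesis
      proof (cases a)
        case (Turn q s)
        let ?t = "addv (turnv q t) s"
        have dec: "decide U c t = Act (Turn q s)" using Act Turn by simp
        note z = decide_moves[OF f dec Suc.prems(3)]
        have m': "march (decide U) N (n - 1) ((r + q) mod 12) (turn q c) ?t = Some (r', t')"
          using m by (simp add: dec)
        obtain k where k: "((r + q) mod 12 + k) mod 12 = r'" "(f ^^ (n - 1)) (f z) = (rot ^^ k) (f z - vr ?t) + vr t'"
          using Suc.IH[OF m' _ z(2)] by auto
        have "f z - vr ?t = (rot ^^ q) (z - vr t)"
          by (simp add: z(1) vr_addv vr_turnv rot_pow_diff)
        moreover have "(f ^^ n) z = (f ^^ (n - 1)) (f z)"
          using False funpow_Suc_right[of "n - 1" f] by (simp del: funpow.simps)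
        ultimately have "(f ^^ n) z = (rot ^^ (k + q)) (z - vr t) + vr t'"
          using k(2) by (simp add: funpow_add)
        moreover have "(r + (k + q)) mod 12 = r'" using k(1) by (simp add: mod_simps ac_simps)
        ultimately show ?thesis by blast
      qed (use m Act in simp)
    next
      case (Split j b)
      then have m': "march (decide U) N n r (part j b c t) t = Some (r', t')"
        "march (decide U) N n r (part (j + 6) (opp b) c t) t = Some (r', t')"
        using m by (simp_all add: agree_Some)
      show ?thesis
      proof (cases "above b (6 * e j z)")
        case True
        then show ?thesis using Suc.IH[OF m'(1) Suc.prems(2) part[OF Suc.prems(3)]] by blast
      next
        case False
        then have "above (opp b) (6 * e (j + 6) z)" using above_opp[of b "6 * e j z"] by (simp add: e_opp)
        then show ?thesis using Suc.IH[OF m'(2) Suc.prems(2) part[OF Suc.prems(3)]] by blast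
      qed
    qed
  qed
qed

fun link_end :: "vec \<Rightarrow> nat \<Rightarrow> int \<times> int \<Rightarrow> nat \<Rightarrow> vec \<Rightarrow> (nat \<times> vec) option \<Rightarrow> bool" where
  "link_end z0 s l q u None = False"
| "link_end z0 s l q u (Some (r, t)) = (if r = q mod 12 then t = addv z0 (turnv s (scalev l u)) else False)"

fun link :: "(cell \<Rightarrow> vec \<Rightarrow> outcome) \<Rightarrow> vec \<Rightarrow> nat \<Rightarrow> int \<times> int \<Rightarrow> nat \<Rightarrow> cell \<times> act \<Rightarrow> bool" where
  "link d z0 s l n (c, Stop) = False"
| "link d z0 s l n (c, Turn q u) = link_end z0 s l q u (march d 500 n 0 (turn s (scale l c)) z0)"

fun links :: "(cell \<Rightarrow> vec \<Rightarrow> outcome) \<Rightarrow> vec \<Rightarrow> nat \<Rightarrow> int \<times> int \<Rightarrow> nat list \<Rightarrow> (cell \<times> act) list \<Rightarrow> bool" where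
  "links d z0 s l [] [] = True"
| "links d z0 s l (n # ns) (p # ps) =
    (if 0 < n then if link d z0 s l n p then links d z0 s l ns ps else False else False)"
| "links d z0 s l ns ps = False"

text \<open>
The cell \<open>c\<close> is a piece on which the map to be modelled is \<open>rot ^^ q\<close> followed by \<open>u\<close>. The copy of
the cell under the similarity is moved by \<open>n\<close> steps of \<open>f\<close>, and these compose to the copy of that
isometry.
\<close>

lemma link_sound:
  assumes f: "follows U f" and l: "0 < zr2 l" and w: "w \<in> cset c"
    and link: "link (decide U) z0 s l n (c, Turn q u)"
  shows "(f ^^ n) (sim z0 s l w) = sim z0 s l ((rot ^^ q) w + vr u)"
proof -
  obtain r t where m: "march (decide U) 500 n 0 (turn s (scale l c)) z0 = Some (r, t)"
    and r: "r = q mod 12" and t: "t = addv z0 (turnv s (scalev l u))"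
    using link by (cases "march (decide U) 500 n 0 (turn s (scale l c)) z0") (auto split: if_splits)
  have "turnv s (Vec 0 0 0 0) = Vec 0 0 0 0" by (induction s) (simp_all add: turnv_def)
  then have "sim z0 s l w \<in> region (turn s (scale l c)) z0"
    using region_turn[OF cset_scale[OF l w], of s z0] by (cases z0) (simp add: sim_def add.commute)
  from march_sound[OF f m _ this] obtain k where k: "k mod 12 = q mod 12"
    "(f ^^ n) (sim z0 s l w) = (rot ^^ k) ((rot ^^ s) (zr2 l *\<^sub>R w)) + vr t"
    by (auto simp: sim_def r)
  note k(2)
  also have "(rot ^^ k) ((rot ^^ s) (zr2 l *\<^sub>R w)) = (rot ^^ s) ((rot ^^ q) (zr2 l *\<^sub>R w))"
    unfolding rot_mod_cong[OF k(1)] by (metis add.commute comp_apply funpow_add)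
  finally show ?thesis
    by (simp add: sim_def t vr_addv vr_turnv vr_scalev rot_pow_add rot_pow_scale algebra_simps)
qed

lemma links_sound:
  assumes f: "follows U f" and l: "0 < zr2 l"
  shows "links (decide U) z0 s l ns ps \<Longrightarrow> (c, Turn q u) \<in> set ps \<Longrightarrow> w \<in> cset c \<Longrightarrow>
    \<exists>m>0. (f ^^ m) (sim z0 s l w) = sim z0 s l ((rot ^^ q) w + vr u)"
proof (induction ns arbitrary: ps)
  case Nil
  then show ?case by (cases ps) auto
next
  case (Cons n ns)
  then obtain p ps' where ps: "ps = p # ps'" by (cases ps) auto
  with Cons.prems have n: "0 < n" "link (decide U) z0 s l n p" "links (decide U) z0 s l ns ps'"
    by (auto split: if_splits)
  show ?case
  proof (cases "p = (c, Turn q u)")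
    case True
    then show ?thesis using link_sound[OF f l Cons.prems(3), of z0 s n q u] n by blast
  next
    case False
    then show ?thesis using Cons.IH[OF n(3) _ Cons.prems(3)] Cons.prems(2) ps by auto
  qed
qed

lemma links_noStop: "links d z0 s l ns ps \<Longrightarrow> (c, Stop) \<notin> set ps"
proof (induction ns arbitrary: ps)
  case Nil
  then show ?case by (cases ps) auto
next
  case (Cons n ns)
  then show ?case by (cases ps) (auto split: if_splits)
qed

corollary links_step:
  assumes f: "follows U f" and l: "0 < zr2 l" and links: "links (decide U) z0 s l ns (pieces S c)" and w: "w \<in> cset c"
  shows "\<exists>m>0. (f ^^ m) (sim z0 s l w) = sim z0 s l (step S w)"
proof -
  obtain c' where c': "(c', select S w) \<in> set (pieces S c)" "w \<in> cset c'"
    using pieces_cover[OF w] by blast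
  then obtain q u where qu: "select S w = Turn q u"
    using links_noStop[OF links] by (metis act.exhaust)
  then show ?thesis
    using links_sound[OF f l links, of c' q u w] c' by (simp add: step_def)
qed

fun lands :: "tree \<Rightarrow> cell \<times> act \<Rightarrow> bool" where
  "lands G (c, Stop) = False"
| "lands G (c, Turn q u) = (case decide G (turn q c) u of Split j b \<Rightarrow> False | Act a \<Rightarrow> a = Stop)"

lemma lands_sound:
  assumes lands: "list_all (lands G) (pieces S c)" and w: "w \<in> cset c"
  shows "select G (step S w) = Stop"
proof -
  obtain c' where c': "(c', select S w) \<in> set (pieces S c)" "w \<in> cset c'"
    using pieces_cover[OF w] by blast
  then have l: "lands G (c', select S w)" using lands by (auto simp: list_all_iff)
  then obtain q u where qu: "select S w = Turn q u" by (cases "select S w") auto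
  have "turnv q (Vec 0 0 0 0) = Vec 0 0 0 0" by (induction q) (simp_all add: turnv_def)
  then have "step S w \<in> region (turn q c') u"
    using region_turn[OF c'(2), of q u] by (cases u) (simp add: step_def qu)
  then show ?thesis using l decide_select by (auto simp: qu split: outcome.splits)
qed

section \<open>Orbits of single points\<close>

fun zabove :: "bound \<Rightarrow> int \<times> int \<Rightarrow> bool" where
  "zabove (B a b s) (u, v) = (if s then zpos (u - a) (v - b) else \<not> zpos (a - u) (b - v))"

lemma zabove: "zabove b p \<longleftrightarrow> above b (zr2 p)"
  by (cases b; cases p) (auto simp: zpos_iff zr_diff)

primrec selectv :: "tree \<Rightarrow> vec \<Rightarrow> act" where
  "selectv (Do a) p = a"
| "selectv (Ask j b y n) p = (if zabove b (ev j p) then selectv y p else selectv n p)"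

lemma selectv: "selectv U p = select U (vr p)"
  by (induction U) (simp_all add: zabove zr2_ev)

fun applyv :: "vec \<Rightarrow> act \<Rightarrow> vec" where
  "applyv p (Turn q s) = addv (turnv q p) s"
| "applyv p Stop = p"

definition stepv :: "tree \<Rightarrow> vec \<Rightarrow> vec" where
  "stepv U p = applyv p (selectv U p)"

lemma vr_stepv: "vr (stepv U p) = step U (vr p)"
  by (cases "select U (vr p)") (simp_all add: stepv_def step_def selectv vr_addv vr_turnv)

fun occurs :: "vec \<Rightarrow> vec list \<Rightarrow> bool" where
  "occurs p [] = False"
| "occurs p (v # vs) = (if p = v then True else occurs p vs)"

lemma occurs: "occurs p vs \<longleftrightarrow> p \<in> set vs"
  by (induction vs) auto

text \<open>
Iterates \<open>f\<close> until a point occurs for the second time. The list of the points visited so far is kept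
because the point that repeats need not be the first one.
\<close>

function closes :: "(vec \<Rightarrow> vec) \<Rightarrow> nat \<Rightarrow> vec list \<Rightarrow> vec \<Rightarrow> bool" where
  "closes f n vs p = (if n = 0 then False else if occurs p vs then True else closes f (n - 1) (p # vs) (f p))"
  by auto
termination by (relation "Wellfounded.measure (\<lambda>(f, n, vs, p). n)") auto
declare closes.simps [simp del]

lemma closes_finite_orbit:
  assumes f: "\<And>p. vr (f p) = g (vr p)"
  shows "closes f n vs p \<Longrightarrow> (\<And>v. v \<in> set vs \<Longrightarrow> \<exists>i>0. (f ^^ i) v = p) \<Longrightarrow> finite_orbit g (vr p)"
proof (induction n arbitrary: vs p)
  case 0
  then show ?case by (simp add: closes.simps)
next
  case (Suc n)
  have pow: "vr ((f ^^ i) p) = (g ^^ i) (vr p)" for i p by (induction i) (simp_all add: f)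
  show ?case
  proof (cases "p \<in> set vs")
    case True
    then obtain i where "i > 0" "(f ^^ i) p = p" using Suc.prems(2) by blast
    then have "(g ^^ 0) (vr p) = (g ^^ i) (vr p)" using pow[of i p] by simp
    then show ?thesis using \<open>i > 0\<close> unfolding finite_orbit_iff by blast
  next
    case False
    then have "closes f n (p # vs) (f p)" using Suc.prems(1) by (simp add: closes.simps[of _ "Suc n"] occurs)
    moreover have "\<exists>i>0. (f ^^ i) v = f p" if "v \<in> set (p # vs)" for v
    proof (cases "v = p")
      case True
      then show ?thesis by (intro exI[of _ 1]) simp
    next
      case False
      then have "v \<in> set vs" using that by simp
      then obtain i where "(f ^^ i) v = p" using Suc.prems(2) by blast
      then show ?thesis by (intro exI[of _ "Suc i"]) simp
    qed
    ultimately have "finite_orbit g (vr (f p))" by (rule Suc.IH)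
    then show ?thesis using finite_orbit_funpow[of g 1 "vr p"] by (simp add: f)
  qed
qed

section \<open>Code equations\<close>

lemma ev_simps:
  "ev 0 (Vec x x' y y') = (x, x')"
  "ev (Suc 0) (Vec x x' y y') = (3 * x' + y, x + y')"
  "ev (Suc (Suc 0)) (Vec x x' y y') = (2 * x + 3 * y', 2 * x' + y)"
  "ev 1 (Vec x x' y y') = (3 * x' + y, x + y')"
  "ev 2 (Vec x x' y y') = (2 * x + 3 * y', 2 * x' + y)"
  "ev 3 (Vec x x' y y') = (3 * x' + 2 * y, x + 2 * y')"
  "ev 4 (Vec x x' y y') = (x + 3 * y', x' + y)"
  "ev 5 (Vec x x' y y') = (y, y')"
  "ev 6 (Vec x x' y y') = (- x, - x')"
  "ev 7 (Vec x x' y y') = (- (3 * x' + y), - (x + y'))"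
  "ev 8 (Vec x x' y y') = (- (2 * x + 3 * y'), - (2 * x' + y))"
  "ev 9 (Vec x x' y y') = (- (3 * x' + 2 * y), - (x + 2 * y'))"
  "ev 10 (Vec x x' y y') = (- (x + 3 * y'), - (x' + y))"
  "ev 11 (Vec x x' y y') = (- y, - y')"
  by (simp_all add: ev_def turnv_def numeral_eq_Suc)

primrec turn5 :: "cell \<Rightarrow> cell" where
  "turn5 (Cell b0 b1 b2 b3 b4 b5 b6 b7 b8 b9 b10 b11) = Cell b5 b6 b7 b8 b9 b10 b11 b0 b1 b2 b3 b4"

text \<open>
The rotation by five steps occurs in each step of \<open>T\<close> and is evaluated directly.
\<close>

lemma turn_code [code]:
  "turn q c = (if q = 5 then turn5 c else if q = 0 then c else turn (q - 1) (turn1 c))"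
  by (cases c; cases q) (simp_all add: turn_def numeral_eq_Suc funpow_swap1)

lemma turnv_code [code]:
  "turnv q (Vec x x' y y') = (if q = 5 then Vec y y' (- x - 3 * y') (- x' - y)
     else if q = 0 then Vec x x' y y' else turnv (q - 1) (rotv (Vec x x' y y')))"
  by (cases q) (simp_all add: turnv_def numeral_eq_Suc funpow_swap1)

lemma ev_code [code]:
  "ev j (Vec x x' y y') = (if j = 1 then (3 * x' + y, x + y') else if j = 2 then (2 * x + 3 * y', 2 * x' + y)
     else if j = 0 then (x, x') else fstv (turnv j (Vec x x' y y')))"
  by (simp add: ev_simps) (simp add: ev_def)

lemma settle_code [code]:
  "settle (Cell b0 b1 b2 b3 b4 b5 b6 b7 b8 b9 b10 b11) (Vec x x' y y') = Cell (shift b0 (x, x')) (shift b1 (3 * x' + y, x + y')) (shift b2 (2 * x + 3 * y', 2 * x' + y)) (shift b3 (3 * x' + 2 * y, x + 2 * y')) (shift b4 (x + 3 * y', x' + y)) (shift b5 (y, y')) (shift b6 (- x, - x')) (shift b7 (- (3 * x' + y), - (x + y'))) (shift b8 (- (2 * x + 3 * y'), - (2 * x' + y))) (shift b9 (- (3 * x' + 2 * y), - (x + 2 * y'))) (shift b10 (- (x + 3 * y'), - (x' + y))) (shift b11 (- y, - y'))"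
  by (simp add: ev_simps)

section \<open>The map of the square and the maps of the triangle\<close>

text \<open>
The leaves are the pieces of \<open>T\<close> according to \<open>k = \<lceil>x + sqrt 3 * y\<rceil>\<close>, with values 3, 2, 1, 0. The last one
occurs in the square only at the origin.
\<close>

definition T_tree :: tree where
  "T_tree = Ask 4 (B 0 0 True)
     (Ask 4 (B 6 0 True)
       (Ask 4 (B 12 0 True) (Do (Turn 5 (Vec 0 0 18 0))) (Do (Turn 5 (Vec 0 0 12 0))))
       (Do (Turn 5 (Vec 0 0 6 0))))
     (Do (Turn 5 (Vec 0 0 0 0)))"

text \<open>
The three comparisons describe \<open>Phi 0 ` triangle\<close>. The constant in the first one is
\<open>6 * (1 + sqrt 3 - kappa\<^sup>2) = - 36 + 30 * sqrt 3\<close>.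
\<close>

definition T_target_tree :: tree where
  "T_target_tree = Ask 1 (B (- 36) 30 True)
     (Ask 6 (B (- 6) 0 True) (Ask 11 (B (- 6) 0 True) (Do Stop) T_tree) T_tree) T_tree"

text \<open>
The map that \<open>T\<close> induces on the triangle at level 0, through returns to \<open>Phi 0 ` triangle\<close>. The line \<open>2 * x + sqrt 3 * y = sqrt 3 - 1\<close> and
the line \<open>sqrt 3 * x + y = 2 - sqrt 3\<close> separate the three open pieces; the remaining leaves are
segments on these lines and a point. The isometry at the point and the map on the last piece are
parameters.
\<close>

definition even_tree :: "act \<Rightarrow> tree \<Rightarrow> tree" where
  "even_tree p c = Ask 2 (B (- 6) 6 True) (Do (Turn 7 (Vec 6 0 0 0)))
     (Ask 2 (B (- 6) 6 False)
       (Ask 5 (B 12 (- 6) True) (Do (Turn 5 (Vec (- 12) 6 (- 12) 12)))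
         (Ask 5 (B 12 (- 6) False) (Do p) (Do (Turn 10 (Vec (- 6) 6 (- 12) 6)))))
     (Ask 1 (B 12 (- 6) True) (Do (Turn 1 (Vec (- 12) 6 (- 6) 6)))
     (Ask 1 (B 12 (- 6) False) (Do (Turn 8 (Vec (- 18) 12 (- 18) 12)))
       c)))"

text \<open>
The map that takes the place of the previous one at odd levels. The three open pieces and their
isometries are the same, but the segments behave differently, and there is an additional segment
\<open>sqrt 3 * x + 2 * y = 1\<close> inside the first piece.
\<close>

definition odd_tree :: "tree \<Rightarrow> tree" where
  "odd_tree c = Ask 2 (B (- 6) 6 True)
       (Ask 3 (B 6 0 True) (Do (Turn 7 (Vec 6 0 0 0)))
         (Ask 3 (B 6 0 False)
           (Ask 0 (B 12 (- 6) True) (Do (Turn 10 (Vec (- 6) 6 (- 12) 6)))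
             (Ask 0 (B 12 (- 6) False) (Do (Turn 2 (Vec 6 (- 6) 6 0))) (Do (Turn 7 (Vec 6 0 0 0)))))
           (Do (Turn 7 (Vec 6 0 0 0)))))
     (Ask 2 (B (- 6) 6 False) (Do (Turn 10 (Vec (- 6) 6 (- 12) 6)))
     (Ask 1 (B 12 (- 6) True) (Do (Turn 1 (Vec (- 12) 6 (- 6) 6)))
     (Ask 1 (B 12 (- 6) False) (Do (Turn 5 (Vec 0 0 (- 6) 6)))
       c)))"

text \<open>
The last piece contains a segment with an isometry of its own.
\<close>

definition even_tail :: tree where
  "even_tail = Ask 3 (B 12 (- 6) True) (Do (Turn 0 (Vec 0 0 (- 6) 6)))
     (Ask 3 (B 12 (- 6) False) (Do (Turn 5 (Vec 0 0 (- 6) 6))) (Do (Turn 0 (Vec 0 0 (- 6) 6))))"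

definition S_even :: tree where "S_even = even_tree (Turn 10 (Vec (- 6) 6 (- 12) 6)) even_tail"

text \<open>
At a single point an isometry is not determined by its value. This tree describes the same map as
\<open>S_even\<close>, but at the exceptional point it uses the rotation that belongs to the even levels after
the first one.
\<close>

definition S_even' :: tree where "S_even' = even_tree (Turn 4 (Vec 18 (- 12) 18 (- 6))) even_tail"
definition S_even_target :: tree where "S_even_target = even_tree (Turn 10 (Vec (- 6) 6 (- 12) 6)) (Do Stop)"
definition S_odd :: tree where "S_odd = odd_tree (Do (Turn 0 (Vec 0 0 (- 6) 6)))"
definition S_odd_target :: tree where "S_odd_target = odd_tree (Do Stop)"

text \<open>
The action at the leaves other than \<open>Stop\<close> is arbitrary: the tree serves to recognise the triangle.
\<close>

definition D_tree :: tree where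
  "D_tree = Ask 0 (B 0 0 True) (Ask 5 (B 0 0 True) (Ask 7 (B (- 6) 0 True) (Do Stop)
     (Do (Turn 0 (Vec 0 0 0 0)))) (Do (Turn 0 (Vec 0 0 0 0)))) (Do (Turn 0 (Vec 0 0 0 0)))"

definition "decide_T = decide T_tree"
definition "decide_T_target = decide T_target_tree"
definition "decide_S_even = decide S_even"
definition "decide_S_even_target = decide S_even_target"
definition "decide_S_odd = decide S_odd"
definition "decide_S_odd_target = decide S_odd_target"
definition "stepv_e = stepv S_even"
definition "stepv_o = stepv S_odd"

lemma decide_S_code [code]:
  "decide_S_even c t = decide S_even c t" "decide_S_even_target c t = decide S_even_target c t"
  "decide_S_odd c t = decide S_odd c t" "decide_S_odd_target c t = decide S_odd_target c t"
  "stepv_e p = stepv S_even p" "stepv_o p = stepv S_odd p"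
  by (simp_all add: decide_S_even_def decide_S_even_target_def decide_S_odd_def decide_S_odd_target_def stepv_e_def stepv_o_def)

fun branch_T :: "bound \<Rightarrow> bound \<Rightarrow> int \<times> int \<Rightarrow> outcome" where
  "branch_T b4 b10 u =
    (if meets b4 u (B 0 0 True) then
       if meets b4 u (B 6 0 True) then
         if meets b4 u (B 12 0 True) then Act (Turn 5 (Vec 0 0 18 0))
         else if avoids b10 u (B 12 0 True) then Act (Turn 5 (Vec 0 0 12 0)) else Split 4 (B 12 0 True)
       else if avoids b10 u (B 6 0 True) then Act (Turn 5 (Vec 0 0 6 0)) else Split 4 (B 6 0 True)
     else if avoids b10 u (B 0 0 True) then Act (Turn 5 (Vec 0 0 0 0)) else Split 4 (B 0 0 True))"

lemma decide_T_code [code]: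
  "decide_T (Cell b0 b1 b2 b3 b4 b5 b6 b7 b8 b9 b10 b11) (Vec x x' y y') = branch_T b4 b10 (x + 3 * y', x' + y)"
  by (simp add: decide_T_def T_tree_def low_simps ev_simps)

lemma decide_T_target_code [code]:
  "decide_T_target (Cell b0 b1 b2 b3 b4 b5 b6 b7 b8 b9 b10 b11) (Vec x x' y y') =
    (if meets b1 (3 * x' + y, x + y') (B (- 36) 30 True) then
       if meets b6 (- x, - x') (B (- 6) 0 True) then
         if meets b11 (- y, - y') (B (- 6) 0 True) then Act Stop
         else if avoids b5 (- y, - y') (B (- 6) 0 True) then branch_T b4 b10 (x + 3 * y', x' + y)
         else Split 11 (B (- 6) 0 True)
       else if avoids b0 (- x, - x') (B (- 6) 0 True) then branch_T b4 b10 (x + 3 * y', x' + y)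
       else Split 6 (B (- 6) 0 True)
     else if avoids b7 (3 * x' + y, x + y') (B (- 36) 30 True) then branch_T b4 b10 (x + 3 * y', x' + y)
     else Split 1 (B (- 36) 30 True))"
  by (simp add: decide_T_target_def T_target_tree_def low_simps ev_simps decide_T_code[unfolded decide_T_def])

section \<open>Verification by evaluation\<close>

definition square_cell :: cell where
  "square_cell = Cell (B 0 0 False) (B 0 0 False) (B 0 0 False) (B 0 0 False) (B 0 0 False) (B 0 0 False) (B (-6) 0 True) (B (-6) (-6) True) (B (-12) (-6) True) (B (-12) (-6) True) (B (-6) (-6) True) (B (-6) 0 True)"

definition D_cell :: cell where
  "D_cell = Cell (B 0 0 True) (B 0 0 True) (B 0 0 True) (B 0 0 True) (B 0 0 True) (B 0 0 True) (B 0 (-2) True) (B (-6) 0 True) (B 0 (-6) True) (B (-12) 0 True) (B 0 (-6) True) (B (-6) 0 True)"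

definition unseen :: "cell \<Rightarrow> nat option" where "unseen c = None"

text \<open>
Cells that the exploration of the square meets several times, each with an upper bound for its hitting time.
At these cells branches of the exploration meet again. The bounds are verified in \<open>computed_known\<close>.
\<close>

definition known :: "(cell \<times> nat) list" where
  "known = [(Cell (B 36 (-18) False) (B 54 (-24) True) (B (-108) 72 True) (B 162 (-84) True) (B (-144) 90 True) (B 108
      (-60) True) (B (-36) 18 False) (B 3 (-9) True) (B 9 (-15) True) (B (-48) 18 True) (B 45 (-33) True) (B (-51)
      27 True), 59),
   (Cell (B 63 (-33) True) (B (-36) 30 False) (B 84 (-36) True) (B (-72) 54 True) (B 78 (-36) True) (B (-36) 24
      True) (B (-6) 0 True) (B (-30) 8 True) (B 30 (-30) True) (B (-60) 22 True) (B 36 (-30) True) (B (-63) 33 True), 268),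
   (Cell (B 96 (-52) True) (B (-36) 30 False) (B 84 (-36) True) (B (-72) 54 True) (B 78 (-36) True) (B (-36) 24
      True) (B (-6) 0 True) (B (-42) 15 True) (B 51 (-42) True) (B (-84) 36 True) (B 102 (-68) True) (B (-120) 66
      True), 268),
   (Cell (B 54 (-30) True) (B (-60) 38 True) (B 60 (-30) True) (B (-96) 60 True) (B 120 (-66) True) (B (-102) 60
      True) (B 60 (-36) True) (B (-6) 0 False) (B 54 (-36) True) (B (-102) 54 True) (B 108 (-66) True) (B (-96) 54
      True), 332),
   (Cell (B (-36) 24 True) (B 78 (-36) True) (B (-72) 54 True) (B 84 (-36) True) (B (-36) 30 False) (B (-15) 12
      False) (B 72 (-45) False) (B (-120) 60 False) (B 108 (-75) False) (B (-105) 48 False) (B 36 (-30) False) (B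
      (-6) 0 True), 85),
   (Cell (B 0 0 False) (B 0 2 False) (B 6 0 False) (B 0 4 False) (B 6 0 False) (B 24 (-12) True) (B (-42) 24 True)
      (B 48 (-30) True) (B (-48) 24 True) (B 48 (-32) True) (B (-48) 24 True) (B 24 (-16) True), 287),
   (Cell (B 54 (-30) True) (B (-36) 24 True) (B 18 (-6) True) (B 18 (-6) True) (B (-12) 10 True) (B 12 (-6) True)
      (B (-6) 2 True) (B (-6) 0 False) (B 54 (-36) True) (B (-102) 54 True) (B 108 (-66) True) (B (-96) 54 True), 332),
   (Cell (B (-30) 20 True) (B 54 (-24) True) (B (-108) 72 True) (B 162 (-84) True) (B (-144) 90 True) (B 108 (-60)
      True) (B (-36) 18 False) (B 3 (-9) True) (B 9 (-15) True) (B (-48) 18 True) (B 12 (-14) True) (B 6 (-6) True), 327),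
   (Cell (B (-36) 24 True) (B 78 (-36) True) (B (-72) 54 True) (B 84 (-36) True) (B (-36) 30 False) (B 30 (-14)
      True) (B (-6) 0 True) (B (-6) (-6) True) (B (-12) (-6) True) (B (-12) (-6) True) (B (-6) (-6) True) (B (-6) 0
      True), 353),
   (Cell (B 54 (-28) True) (B (-18) 18 True) (B 0 10 True) (B 48 (-18) True) (B (-30) 24 True) (B 24 (-12) True)
      (B (-6) 0 True) (B (-24) 6 False) (B 48 (-38) False) (B (-90) 42 False) (B 78 (-52) False) (B (-66) 36 False), 282),
   (Cell (B (-60) 36 True) (B 48 (-24) True) (B (-12) 12 False) (B 36 (-16) False) (B (-36) 24 False) (B 36 (-20)
      False) (B (-24) 12 False) (B 24 (-18) True) (B (-30) 12 True) (B 12 (-12) True) (B (-48) 24 True) (B 60 (-36)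
      True), 355),
   (Cell (B 54 (-28) True) (B (-18) 18 True) (B 0 10 True) (B 48 (-18) True) (B (-30) 24 True) (B 24 (-12) True)
      (B (-6) 0 True) (B 0 (-8) True) (B (-18) 0 False) (B (-33) 9 False) (B 45 (-33) False) (B (-66) 36 False), 325),
   (Cell (B (-60) 36 True) (B 48 (-24) True) (B (-12) 12 False) (B 12 (-2) False) (B 6 0 False) (B 12 (-6) True)
      (B (-24) 12 True) (B 24 (-18) True) (B (-30) 12 True) (B 12 (-12) True) (B (-48) 24 True) (B 60 (-36) True), 355),
   (Cell (B (-12) 8 True) (B 6 0 True) (B 0 4 True) (B 6 0 True) (B 0 2 True) (B 0 0 False) (B 6 (-6) True) (B
      (-18) 6 True) (B 12 (-12) True) (B 12 (-12) False) (B (-24) 10 True) (B 18 (-12) True), 387),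
   (Cell (B 54 (-28) True) (B (-18) 18 True) (B 0 10 True) (B 48 (-18) True) (B (-30) 24 True) (B 24 (-12) True)
      (B (-6) 0 True) (B (-66) 30 True) (B 96 (-66) True) (B (-132) 66 True) (B 102 (-66) True) (B (-66) 36 False), 340),
   (Cell (B 0 0 False) (B 24 (-12) True) (B (-36) 24 True) (B 48 (-24) True) (B (-36) 24 True) (B 24 (-12) True)
      (B (-42) 24 True) (B 48 (-30) True) (B (-48) 24 False) (B 48 (-32) False) (B (-48) 24 False) (B 24 (-16)
      False), 383)]"

definition seen :: "nat \<Rightarrow> cell \<Rightarrow> nat option" where
  "seen i = search i 0 known"

text \<open>
The search is unfolded to a chain of conditionals, so that only as many cells are inspected as
necessary.
\<close>

lemma seen_search: "seen i c = search i 0 known c" by (simp add: seen_def)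
lemmas seen_code [code] = seen_search[unfolded known_def search.simps fst_conv snd_conv, simplified]

fun at_most :: "nat \<Rightarrow> nat option \<Rightarrow> bool" where
  "at_most m None = False"
| "at_most m (Some m') = (m' \<le> m)"

fun check_known :: "nat \<Rightarrow> (cell \<times> nat) list \<Rightarrow> bool" where
  "check_known i [] = True"
| "check_known i (x # xs) =
    (if at_most (snd x) (explore decide_T_target (seen i) 400 70 (fst x)) then check_known (i + 1) xs else False)"

fun in_unit :: "int \<times> int \<Rightarrow> bool" where
  "in_unit (a, b) = (if zpos a b then zpos (1 - a) (- b) else False)"

text \<open>
Pairs \<open>(a, b)\<close> with \<open>0 < a + b * sqrt 3 < 1\<close> whose conjugate \<open>a - b * sqrt 3\<close> has absolute value at
most 50; the ranges for \<open>a\<close> and \<open>b\<close> follow from these two conditions.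
\<close>

definition unit_coords :: "(int \<times> int) list" where
  "unit_coords = filter in_unit (List.product [-25..25] [-14..14])"

text \<open>
The first test selects the points of the triangle, the second one skips points whose conjugate has
norm greater than 25.
\<close>

fun check_row :: "(vec \<Rightarrow> vec) \<Rightarrow> int \<Rightarrow> int \<Rightarrow> (int \<times> int) list \<Rightarrow> bool" where
  "check_row f a b [] = True"
| "check_row f a b ((c, d) # ys) =
    (if zpos (1 - 3 * b - c) (- a - d)
     then if zpos (a * a + 3 * (b * b) + c * c + 3 * (d * d) + 3 * (a * d + b * c) - 625)
         (- 2 * (a * b) - 2 * (c * d) - (a * c + 3 * (b * d))) then check_row f a b ys
       else if closes f 30 [] (Vec (6 * a) (6 * b) (6 * c) (6 * d)) then check_row f a b ys else False
     else check_row f a b ys)"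

fun check_rows :: "(vec \<Rightarrow> vec) \<Rightarrow> (int \<times> int) list \<Rightarrow> (int \<times> int) list \<Rightarrow> bool" where
  "check_rows f [] ys = True"
| "check_rows f ((a, b) # xs) ys = (if check_row f a b ys then check_rows f xs ys else False)"

lemma computed_stay: "list_all (lands D_tree) (pieces S_even D_cell)" "list_all (lands D_tree) (pieces S_odd D_cell)"
  by code_simp+

text \<open>
The numbers count, for the successive pieces of \<open>S_odd\<close>, the steps of \<open>S_even\<close> that carry
\<open>kappa *\<^sub>R w\<close> to the image of \<open>w\<close> under \<open>S_odd\<close>, scaled by \<open>kappa\<close>.
\<close>

lemma computed_link_odd: "links decide_S_even (Vec 0 0 0 0) 0 (2, - 1) [2, 6, 6, 20, 2, 4, 8, 8, 13] (pieces S_odd D_cell)"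
  by code_simp

lemma computed_link_even: "links decide_S_odd (Vec 0 0 0 0) 0 (2, - 1) [2, 8, 13, 16, 8, 12, 13, 9, 13] (pieces S_even' D_cell)"
  by code_simp

lemma computed_link_T: "links decide_T (Vec 6 0 6 0) 6 (7, - 4) [59, 145, 242, 242, 101, 412, 144, 145, 144] (pieces S_even D_cell)"
  by code_simp

lemma computed_cover_even: "explore decide_S_even_target unseen 12 20 D_cell = Some 19"
  by code_simp

lemma computed_cover_odd: "explore decide_S_odd_target unseen 20 30 D_cell = Some 15"
  by code_simp

lemma computed_known: "check_known 0 known"
  by code_simp

lemma computed_cover_square: "explore decide_T_target (seen 16) 400 70 square_cell \<noteq> None"
  by code_simp

lemma computed_points: "check_rows stepv_e unit_coords unit_coords" "check_rows stepv_o unit_coords unit_coords"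
  by code_simp+

section \<open>Renormalisation of the triangle\<close>

lemma rot_values:
  "(rot ^^ Suc 0) (x, y) = (sqrt 3 * x + y, - x)"
  "(rot ^^ 2) (x, y) = (2 * x + sqrt 3 * y, - (sqrt 3 * x + y))"
  "(rot ^^ 4) (x, y) = (x + sqrt 3 * y, - (sqrt 3 * x + 2 * y))"
  "(rot ^^ 5) (x, y) = (y, - (x + sqrt 3 * y))"
  "(rot ^^ 7) (x, y) = (- (sqrt 3 * x + y), x)"
  "(rot ^^ 8) (x, y) = (- (2 * x + sqrt 3 * y), sqrt 3 * x + y)"
  "(rot ^^ 10) (x, y) = (- (x + sqrt 3 * y), sqrt 3 * x + 2 * y)"
  by (simp_all add: rot_def numeral_eq_Suc algebra_simps)

lemma sqrt3_bounds: "173 / 100 < sqrt 3" "sqrt 3 < 174 / 100"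
  by (rule real_less_rsqrt, simp add: power2_eq_square) (rule real_less_lsqrt, simp_all add: power2_eq_square)

definition triangle :: "(real \<times> real) set" where
  "triangle = {(x, y). 0 < x \<and> 0 < y \<and> sqrt 3 * x + y < 1}"

definition square :: "(real \<times> real) set" where
  "square = {0..<1} \<times> {0..<1}"

lemma triangle_D_cell: "w \<in> triangle \<Longrightarrow> w \<in> cset D_cell"
proof -
  assume w: "w \<in> triangle"
  obtain x y where xy: "w = (x, y)" by fastforce
  have d: "0 < x" "0 < y" "sqrt 3 * x + y < 1" using w by (auto simp: triangle_def xy)
  have p: "0 < sqrt 3 * x" "0 < sqrt 3 * y" using d by simp_all
  have "sqrt 3 * (sqrt 3 * x + y) < sqrt 3 * 1" using d(3) by (intro mult_strict_left_mono) simp_all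
  then have "3 * x + sqrt 3 * y < sqrt 3" by (simp add: algebra_simps)
  then show ?thesis
    using d p unfolding region_iff all_less_12 vr_zero diff_zero xy D_cell_def
    by (simp add: low_simps e_values zr_def; intro conjI; (linarith | (simp add: algebra_simps; linarith)))
qed

lemma square_square_cell: "z \<in> square \<Longrightarrow> z \<in> cset square_cell"
proof -
  assume z: "z \<in> square"
  obtain x y where xy: "z = (x, y)" by fastforce
  have d: "0 \<le> x" "0 \<le> y" "x < 1" "y < 1" using z by (auto simp: square_def xy)
  have p: "0 \<le> sqrt 3 * x" "0 \<le> sqrt 3 * y" "sqrt 3 * x < sqrt 3" "sqrt 3 * y < sqrt 3" using d by simp_all
  then show ?thesis
    using d unfolding region_iff all_less_12 vr_zero diff_zero xy square_cell_def
    by (simp add: low_simps e_values zr_def; intro conjI; (linarith | (simp add: algebra_simps; linarith)))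
qed

lemma D_tree: "select D_tree w = Stop \<longleftrightarrow> w \<in> triangle"
  by (cases w) (auto simp: D_tree_def triangle_def e_values zr_def algebra_simps)

text \<open>
At the exceptional point \<open>(1 - sqrt 3 / 2, 2 - sqrt 3)\<close> the two isometries have the same value.
\<close>

lemma step_S_even': "step S_even' w = step S_even w"
proof -
  obtain x y where w: "w = (x, y)" by fastforce
  show ?thesis
  proof (cases "2 * x + sqrt 3 * y = sqrt 3 - 1 \<and> y = 2 - sqrt 3")
    case True
    then have y: "y = 2 - sqrt 3" and xy: "2 * x + sqrt 3 * y = sqrt 3 - 1" by blast+
    have "sqrt 3 * y = 2 * sqrt 3 - 3" by (simp add: y algebra_simps)
    then have x: "x = 1 - sqrt 3 / 2" using xy by linarith
    have "(rot ^^ 4) w + vr (Vec 18 (- 12) 18 (- 6)) = (rot ^^ 10) w + vr (Vec (- 6) 6 (- 12) 6)"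
      by (simp add: w x y rot_values vr.simps zr_def field_simps)
    then show ?thesis
      by (simp add: step_def S_even_def S_even'_def even_tree_def)
  next
    case False
    then have "\<not> (above (B (- 6) 6 False) (6 * e 2 w) \<and> \<not> above (B (- 6) 6 True) (6 * e 2 w)
        \<and> above (B 12 (- 6) False) (6 * e 5 w) \<and> \<not> above (B 12 (- 6) True) (6 * e 5 w))"
      by (auto simp: w e_values zr_def algebra_simps)
    then show ?thesis by (auto simp: step_def S_even_def S_even'_def even_tree_def)
  qed
qed

definition kappa :: real where "kappa = 2 - sqrt 3"

lemma kappa_pos: "0 < kappa" and kappa_less: "kappa < 27 / 100" and kappa_inv: "(2 + sqrt 3) * kappa = 1"
  using sqrt3_bounds by (auto simp: kappa_def algebra_simps)

lemma scale_triangle: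
  "0 < k \<Longrightarrow> k *\<^sub>R (x, y) \<in> triangle \<longleftrightarrow> 0 < x \<and> 0 < y \<and> k * (sqrt 3 * x + y) < 1"
  by (auto simp: triangle_def zero_less_mult_iff algebra_simps)

lemma kappa_triangle: "w \<in> triangle \<Longrightarrow> kappa *\<^sub>R w \<in> triangle"
proof -
  assume w: "w \<in> triangle"
  obtain x y where xy: "w = (x, y)" by fastforce
  have d: "0 < x" "0 < y" "sqrt 3 * x + y < 1" using w by (auto simp: triangle_def xy)
  have "kappa * (sqrt 3 * x + y) < kappa * 1" using d(3) kappa_pos by (rule mult_strict_left_mono)
  then have "kappa * (sqrt 3 * x + y) < 1" using kappa_less by linarith
  then show ?thesis unfolding xy scale_triangle[OF kappa_pos] using d by blast
qed

definition Phi :: "nat \<Rightarrow> real \<times> real \<Rightarrow> real \<times> real" where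
  "Phi n w = (1, 1) - kappa ^ (n + 2) *\<^sub>R w"

definition S :: "nat \<Rightarrow> real \<times> real \<Rightarrow> real \<times> real" where
  "S n = (if even n then step S_even else step S_odd)"

lemma Phi_Suc: "Phi (Suc n) w = Phi n (kappa *\<^sub>R w)"
  by (simp add: Phi_def algebra_simps)

lemma sim_kappa: "sim (Vec 0 0 0 0) 0 (2, - 1) w = kappa *\<^sub>R w"
  by (simp add: sim_def kappa_def zr_def)

lemma sim_Phi: "sim (Vec 6 0 6 0) 6 (7, - 4) w = Phi 0 w"
proof -
  have "zr 7 (- 4) = kappa ^ 2" by (simp add: zr_def kappa_def power2_eq_square algebra_simps)
  moreover have "vr (Vec 6 0 6 0) = (1, 1)" by (simp add: vr.simps zr_def)
  ultimately show ?thesis by (simp add: sim_def Phi_def rot_6 power2_eq_square)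
qed

lemma link_T: "w \<in> triangle \<Longrightarrow> \<exists>m>0. (step T_tree ^^ m) (Phi 0 w) = Phi 0 (S 0 w)"
proof -
  assume w: "w \<in> triangle"
  have "0 < zr2 (7, - 4)" using sqrt3_bounds by (simp add: zr_def)
  from links_step[OF follows_step this computed_link_T[unfolded decide_T_def] triangle_D_cell[OF w]]
  show ?thesis by (simp add: sim_Phi S_def)
qed

lemma link_S: "w \<in> triangle \<Longrightarrow> \<exists>m>0. (S n ^^ m) (kappa *\<^sub>R w) = kappa *\<^sub>R S (Suc n) w"
proof -
  assume w: "w \<in> triangle"
  have l: "0 < zr2 (2, - 1)" using kappa_pos by (simp add: zr_def kappa_def)
  show ?thesis
    using links_step[OF follows_step l computed_link_odd[unfolded decide_S_even_def] triangle_D_cell[OF w]]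
      links_step[OF follows_step l computed_link_even[unfolded decide_S_odd_def] triangle_D_cell[OF w]]
    by (cases "even n") (simp_all add: sim_kappa S_def step_S_even')
qed

lemma S_step: "u \<in> triangle \<Longrightarrow> S n u \<in> triangle"
  using lands_sound[OF computed_stay(1) triangle_D_cell] lands_sound[OF computed_stay(2) triangle_D_cell]
  by (auto simp: S_def D_tree)

lemma S_triangle: "w \<in> triangle \<Longrightarrow> (S n ^^ i) w \<in> triangle"
  by (induction i) (simp_all add: S_step)

lemma funpow_conj:
  assumes "\<And>u. u \<in> A \<Longrightarrow> g u \<in> A" "\<And>u. u \<in> A \<Longrightarrow> \<exists>m>0. (f ^^ m) (h u) = h (g u)"
  shows "u \<in> A \<Longrightarrow> \<exists>m\<ge>i. (f ^^ m) (h u) = h ((g ^^ i) u)"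
proof (induction i)
  case (Suc i)
  then obtain m where m: "m \<ge> i" "(f ^^ m) (h u) = h ((g ^^ i) u)" by blast
  have "(g ^^ i) u \<in> A" using Suc.prems assms(1) by (induction i) auto
  then obtain m' where m': "m' > 0" "(f ^^ m') (h ((g ^^ i) u)) = h (g ((g ^^ i) u))" using assms(2) by blast
  then have "(f ^^ (m' + m)) (h u) = h ((g ^^ Suc i) u)" using m by (simp add: funpow_add)
  moreover have "m' + m \<ge> Suc i" using m m' by simp
  ultimately show ?case by blast
qed (intro exI[of _ 0], simp)

text \<open>
The induction step is the renormalisation: \<open>Phi (Suc n) w\<close> is \<open>Phi n (kappa *\<^sub>R w)\<close>, so a return of
the orbit under \<open>S n\<close> to the scaled triangle gives the step at level \<open>Suc n\<close>.
\<close>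

lemma level: "w \<in> triangle \<Longrightarrow> \<exists>m>0. (step T_tree ^^ m) (Phi n w) = Phi n (S n w)"
proof (induction n arbitrary: w)
  case 0
  then show ?case by (rule link_T)
next
  case (Suc n)
  obtain m where m: "m > 0" "(S n ^^ m) (kappa *\<^sub>R w) = kappa *\<^sub>R S (Suc n) w" using link_S[OF Suc.prems] by blast
  have "kappa *\<^sub>R w \<in> triangle" using Suc.prems by (rule kappa_triangle)
  then obtain M where "M \<ge> m" "(step T_tree ^^ M) (Phi n (kappa *\<^sub>R w)) = Phi n ((S n ^^ m) (kappa *\<^sub>R w))"
    using funpow_conj[where A = triangle and g = "S n" and h = "Phi n" and i = m, OF S_step Suc.IH] by blast
  then show ?case using m by (auto simp: Phi_Suc intro!: exI[of _ M])
qed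

lemma level_iter: "w \<in> triangle \<Longrightarrow> \<exists>m\<ge>i. (step T_tree ^^ m) (Phi n w) = Phi n ((S n ^^ i) w)"
  by (rule funpow_conj[where A = triangle and g = "S n" and h = "Phi n", OF S_step level])

lemma S_iter: "w \<in> triangle \<Longrightarrow> \<exists>m\<ge>i. (S n ^^ m) (kappa *\<^sub>R w) = kappa *\<^sub>R ((S (Suc n) ^^ i) w)"
  by (rule funpow_conj[where A = triangle and g = "S (Suc n)" and h = "\<lambda>w. kappa *\<^sub>R w", OF S_step link_S])

lemma finite_orbit_level:
  assumes w: "w \<in> triangle" and "finite_orbit (S n) w"
  shows "finite_orbit (step T_tree) (Phi n w)"
proof -
  obtain i j where ij: "i < j" "(S n ^^ i) w = (S n ^^ j) w" using assms(2) unfolding finite_orbit_iff by blast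
  define u where "u = (S n ^^ i) w"
  have "(S n ^^ (j - i)) u = u" using ij funpow_add[of "j - i" i "S n"] by (simp add: u_def)
  then obtain m where "m \<ge> j - i" "(step T_tree ^^ m) (Phi n u) = Phi n u"
    using level_iter[OF S_triangle[OF w, where n = n and i = i], where i = "j - i" and n = n] by (auto simp: u_def)
  then have "0 < m" "(step T_tree ^^ 0) (Phi n u) = (step T_tree ^^ m) (Phi n u)" using ij by simp_all
  then have "finite_orbit (step T_tree) (Phi n u)" unfolding finite_orbit_iff by blast
  moreover obtain k where "(step T_tree ^^ k) (Phi n w) = Phi n u" using level_iter[OF w] u_def by blast
  ultimately show ?thesis by (metis finite_orbit_funpow)
qed

section \<open>Every orbit reaches the triangle or is finite\<close>

lemma follows_variants: "follows T_target_tree (step T_tree)" "follows S_even_target (step S_even)" "follows S_odd_target (step S_odd)"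
  by (auto simp: follows_def step_def T_target_tree_def S_even_target_def S_even_def S_odd_target_def S_odd_def even_tree_def odd_tree_def split: if_splits)

text \<open>
The scaled triangle is the part of the triangle below a line parallel to its
edge from \<open>(1 / sqrt 3, 0)\<close> to \<open>(0, 1)\<close>. This is the last piece of the maps \<open>S n\<close>.
\<close>

lemma triangle_kappa: "w \<in> triangle \<Longrightarrow> sqrt 3 * fst w + snd w < kappa \<Longrightarrow> \<exists>w'\<in>triangle. w = kappa *\<^sub>R w'"
proof -
  assume w: "w \<in> triangle" and l: "sqrt 3 * fst w + snd w < kappa"
  obtain x y where xy: "w = (x, y)" by fastforce
  have "0 < x" "0 < y" "1 / kappa * (sqrt 3 * x + y) < 1"
    using w l kappa_pos by (auto simp: triangle_def xy)
  then have "(1 / kappa) *\<^sub>R w \<in> triangle" using scale_triangle[of "1 / kappa" x y] kappa_pos by (simp add: xy)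
  moreover have "w = kappa *\<^sub>R ((1 / kappa) *\<^sub>R w)" using kappa_pos by simp
  ultimately show ?thesis by blast
qed

lemma cover_S:
  assumes "w \<in> triangle"
  shows "finite_orbit (S n) w \<or> (\<exists>j\<le>19. \<exists>w'\<in>triangle. (S n ^^ j) w = kappa *\<^sub>R w')"
proof -
  have stop: "\<exists>w'\<in>triangle. u = kappa *\<^sub>R w'"
    if "u \<in> triangle" "select S_even_target u = Stop \<or> select S_odd_target u = Stop" for u
    using that(2) by (intro triangle_kappa[OF that(1)])
      (cases u; auto simp: S_even_target_def S_odd_target_def even_tree_def odd_tree_def e_values zr_def kappa_def split: if_splits)
  have g: "good S_even_target (step S_even) 19 w"
    by (rule explore_sound[OF follows_variants(2) _ computed_cover_even[unfolded decide_S_even_target_def] triangle_D_cell[OF assms]])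
      (simp add: unseen_def)
  have "good S_odd_target (step S_odd) 15 w"
    by (rule explore_sound[OF follows_variants(3) _ computed_cover_odd[unfolded decide_S_odd_target_def] triangle_D_cell[OF assms]])
      (simp add: unseen_def)
  then have g': "good S_odd_target (step S_odd) 19 w" by (rule good_mono) simp
  from g g' consider "finite_orbit (S n) w"
    | j where "j \<le> 19" "select S_even_target ((S n ^^ j) w) = Stop \<or> select S_odd_target ((S n ^^ j) w) = Stop"
    unfolding good_def by (cases "even n") (auto simp: S_def)
  then show ?thesis
  proof cases
    case (2 j)
    then show ?thesis using stop[OF S_triangle[OF assms, where n = n and i = j] 2(2)] by blast
  qed blast
qed

lemma seen_good: "seen i c = Some m \<Longrightarrow> z \<in> cset c \<Longrightarrow> good T_target_tree (step T_tree) m z"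
proof -
  have chk: "check_known i xs \<Longrightarrow> k < length xs \<Longrightarrow>
    at_most (snd (xs ! k)) (explore decide_T_target (seen (i + k)) 400 70 (fst (xs ! k)))" for i k xs
  proof (induction xs arbitrary: i k)
    case (Cons x xs)
    then show ?case by (cases k) (auto split: if_splits simp del: at_most.simps dest: Cons.IH)
  qed simp
  have am: "at_most m x \<Longrightarrow> \<exists>m'\<le>m. x = Some m'" for m x by (cases x) auto
  assume "seen i c = Some m" "z \<in> cset c"
  then show ?thesis
    unfolding seen_def
    using am[OF chk[OF computed_known]] follows_variants(1)
    by (intro explore_list_sound[of T_target_tree "step T_tree" known 400 70]) (simp_all add: seen_def decide_T_target_def)
qed

lemma cover_T:
  assumes "z \<in> square"
  shows "finite_orbit (step T_tree) z \<or> (\<exists>j. \<exists>w\<in>triangle. (step T_tree ^^ j) z = Phi 0 w)"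
proof -
  have stop: "\<exists>w\<in>triangle. u = Phi 0 w" if "select T_target_tree u = Stop" for u
  proof -
    obtain x y where u: "u = (x, y)" by fastforce
    have k2: "kappa ^ 2 = 7 - 4 * sqrt 3" by (simp add: kappa_def power2_eq_square algebra_simps)
    have "x < 1" "y < 1" "sqrt 3 * (1 - x) + (1 - y) < kappa ^ 2"
      using that by (auto simp: T_target_tree_def T_tree_def u e_values zr_def k2 algebra_simps split: if_splits)
    then have "0 < 1 - x" "0 < 1 - y" "1 / kappa ^ 2 * (sqrt 3 * (1 - x) + (1 - y)) < 1"
      using kappa_pos by simp_all
    then have "(1 / kappa ^ 2) *\<^sub>R ((1, 1) - u) \<in> triangle"
      using scale_triangle[of "1 / kappa ^ 2" "1 - x" "1 - y"] kappa_pos by (simp add: u)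
    moreover have "u = Phi 0 ((1 / kappa ^ 2) *\<^sub>R ((1, 1) - u))" using kappa_pos by (simp add: Phi_def power2_eq_square)
    ultimately show ?thesis by blast
  qed
  obtain m where m: "explore (decide T_target_tree) (seen 16) 400 70 square_cell = Some m"
    using computed_cover_square by (cases "explore decide_T_target (seen 16) 400 70 square_cell") (auto simp: decide_T_target_def)
  have "good T_target_tree (step T_tree) m z"
    by (rule explore_sound[OF follows_variants(1) _ m square_square_cell[OF assms]]) (rule seen_good)
  then show ?thesis unfolding good_def using stop by blast
qed

section \<open>Points of the lattice\<close>

definition pt :: "vec \<Rightarrow> real \<times> real" where
  "pt p = 6 *\<^sub>R vr p"

primrec six :: "vec \<Rightarrow> vec" where
  "six (Vec a b c d) = Vec (6 * a) (6 * b) (6 * c) (6 * d)"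

lemma pt_V: "pt (Vec a b c d) = (zr a b, zr c d)"
  by (simp add: pt_def vr.simps)

lemma vr_six: "vr (six p) = pt p"
  by (cases p) (simp add: pt_V vr.simps zr_def)

lemma pt_addv: "pt (addv p q) = pt p + pt q"
  by (simp add: pt_def vr_addv algebra_simps)

lemma pt_turnv: "pt (turnv k p) = (rot ^^ k) (pt p)"
  by (simp add: pt_def vr_turnv rot_pow_scale)

lemma pt_scalev: "pt (scalev l p) = zr2 l *\<^sub>R pt p"
  by (simp add: pt_def vr_scalev)

text \<open>
This is the twelfth root of unity with argument 30 degrees. The conjugate \<open>(x, y)\<close> of a point is identified with the complex number
\<open>x - omega * y\<close>. The conjugate of \<open>rot\<close> then becomes the multiplication by \<open>- cnj omega\<close>, so it
preserves the absolute value.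
\<close>

definition omega :: complex where "omega = Complex (sqrt 3 / 2) (1 / 2)"

primrec galois :: "vec \<Rightarrow> complex" where
  "galois (Vec a b c d) = of_real (zr a (- b)) - omega * of_real (zr c (- d))"

lemma cmod_omega: "cmod omega = 1"
  by (simp add: omega_def cmod_def power2_eq_square)

lemma galois_addv: "galois (addv p q) = galois p + galois q"
  by (cases p; cases q) (simp add: zr_def algebra_simps)

lemma galois_rotv: "galois (rotv p) = - cnj omega * galois p"
  by (cases p) (simp add: zr_def omega_def complex_eq_iff algebra_simps)

lemma cmod_galois_turnv: "cmod (galois (turnv k p)) = cmod (galois p)"
  unfolding turnv_def by (induction k) (simp_all add: galois_rotv norm_mult cmod_omega)

lemma galois_scalev: "galois (scalev (a, b) p) = of_real (zr a (- b)) * galois p"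
proof -
  have "zr (a * x + 3 * (b * y)) (- (a * y + b * x)) = zr a (- b) * zr x (- y)" for x y
    by (simp add: zr_mult)
  then show ?thesis by (cases p) (simp add: mulz_def algebra_simps)
qed

primrec acts :: "tree \<Rightarrow> act set" where
  "acts (Do a) = {a}"
| "acts (Ask j b y n) = acts y \<union> acts n"

lemma select_acts: "select U z \<in> acts U"
  by (induction U) auto

definition lattice_act :: "real \<Rightarrow> act \<Rightarrow> bool" where
  "lattice_act r a \<longleftrightarrow> (\<exists>q u. a = Turn q (six u) \<and> cmod (galois u) \<le> r)"

lemma lattice_actI: "v = six u \<Longrightarrow> cmod (galois u) \<le> r \<Longrightarrow> lattice_act r (Turn q v)"
  by (auto simp: lattice_act_def)

lemma step_lattice:
  assumes "\<And>a. a \<in> acts U \<Longrightarrow> lattice_act r a"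
  shows "\<exists>p'. pt p' = step U (pt p) \<and> cmod (galois p') \<le> cmod (galois p) + r"
proof -
  obtain q u where qu: "select U (pt p) = Turn q (six u)" "cmod (galois u) \<le> r"
    using assms[OF select_acts[of U "pt p"]] by (auto simp: lattice_act_def)
  show ?thesis
    using qu norm_triangle_ineq[of "galois (turnv q p)" "galois u"]
    by (intro exI[of _ "addv (turnv q p) u"])
      (simp add: pt_addv pt_turnv step_def vr_six galois_addv cmod_galois_turnv)
qed

lemma step_lattice_iter:
  assumes "\<And>a. a \<in> acts U \<Longrightarrow> lattice_act r a"
  shows "\<exists>p'. pt p' = (step U ^^ j) (pt p) \<and> cmod (galois p') \<le> cmod (galois p) + real j * r"
proof (induction j)
  case (Suc j)
  then obtain p' where p': "pt p' = (step U ^^ j) (pt p)" "cmod (galois p') \<le> cmod (galois p) + real j * r" by blast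
  from step_lattice[OF assms, where p = p'] p' show ?case by (fastforce simp: algebra_simps)
qed auto

lemma cmod_galois_le:
  assumes "zr a (- b) ^ 2 - sqrt 3 * (zr a (- b) * zr c (- d)) + zr c (- d) ^ 2 \<le> r\<^sup>2" "0 \<le> r"
  shows "cmod (galois (Vec a b c d)) \<le> r"
proof -
  have "(cmod (galois (Vec a b c d)))\<^sup>2 = zr a (- b) ^ 2 - sqrt 3 * (zr a (- b) * zr c (- d)) + zr c (- d) ^ 2"
    unfolding cmod_power2 by (simp add: omega_def power2_eq_square algebra_simps)
  then show ?thesis using assms by (metis abs_le_square_iff abs_norm_cancel abs_of_nonneg)
qed

text \<open>
The translations of both maps have coordinates in \<open>\<int>[sqrt 3]\<close>, and their conjugates have norm
at most \<open>7 / 2\<close>.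
\<close>

lemma S_acts: "a \<in> acts S_even \<Longrightarrow> lattice_act (7 / 2) a" "a \<in> acts S_odd \<Longrightarrow> lattice_act (7 / 2) a"
proof -
  have c: "cmod (galois (Vec a b c d)) * 2 \<le> 7"
    if "(a, b, c, d) \<in> {(1,0,0,0), (-1,1,-2,1), (-2,1,-1,1), (0,0,-1,1), (-2,1,-2,2), (-3,2,-3,2), (1,-1,1,0)}" for a b c d
  proof -
    have "cmod (galois (Vec a b c d)) \<le> 7 / 2"
      using that sqrt3_bounds by (intro cmod_galois_le) (auto simp: zr_def power2_eq_square algebra_simps)
    then show ?thesis by simp
  qed
  define P where "P = {(7, Vec 1 0 0 0), (5, Vec (- 2) 1 (- 2) 2), (10, Vec (- 1) 1 (- 2) 1),
    (1, Vec (- 2) 1 (- 1) 1), (8, Vec (- 3) 2 (- 3) 2), (0, Vec 0 0 (- 1) 1), (5, Vec 0 0 (- 1) 1),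
    (2 :: nat, Vec 1 (- 1) 1 0)}"
  have sub: "acts S_even \<union> acts S_odd \<subseteq> (\<lambda>(q, u). Turn q (six u)) ` P"
    by (simp add: P_def S_even_def S_odd_def even_tree_def odd_tree_def even_tail_def)
  have small: "\<forall>p\<in>P. cmod (galois (snd p)) \<le> 7 / 2"
    by (auto simp: P_def intro!: c simp del: galois.simps)
  have "lattice_act (7 / 2) a" if "a \<in> acts S_even \<union> acts S_odd" for a
  proof -
    from that sub have "a \<in> (\<lambda>(q, u). Turn q (six u)) ` P" by (rule subsetD[rotated])
    then obtain p where p: "p \<in> P" "a = Turn (fst p) (six (snd p))" by (auto simp: case_prod_beta)
    show ?thesis unfolding p(2) using small p(1) by (intro lattice_actI[OF refl]) blast
  qed
  then show "a \<in> acts S_even \<Longrightarrow> lattice_act (7 / 2) a" "a \<in> acts S_odd \<Longrightarrow> lattice_act (7 / 2) a"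
    by simp_all
qed

lemma in_unit: "in_unit (a, b) \<longleftrightarrow> 0 < zr a b \<and> zr a b < 1"
proof -
  have "zr (1 - a) (- b) = 1 - zr a b" by (simp add: zr_def)
  then show ?thesis by (auto simp: zpos_iff)
qed

lemma check_rows_closes:
  assumes "check_rows f xs ys" "(a, b) \<in> set xs" "(c, d) \<in> set ys"
    and "0 < zr (1 - 3 * b - c) (- a - d)"
    and "zr (a * a + 3 * (b * b) + c * c + 3 * (d * d) + 3 * (a * d + b * c))
           (- 2 * (a * b) - 2 * (c * d) - (a * c + 3 * (b * d))) \<le> 625"
  shows "closes f 30 [] (Vec (6 * a) (6 * b) (6 * c) (6 * d))"
proof -
  let ?p = "a * a + 3 * (b * b) + c * c + 3 * (d * d) + 3 * (a * d + b * c)"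
  let ?q = "- 2 * (a * b) - 2 * (c * d) - (a * c + 3 * (b * d))"
  have "zr (?p - 625) ?q = zr ?p ?q - 625" by (simp add: zr_def)
  then have "\<not> zpos (?p - 625) ?q" "zpos (1 - 3 * b - c) (- a - d)"
    using assms(4,5) unfolding zpos_iff by linarith+
  then have row: "check_row f a b ys \<Longrightarrow> closes f 30 [] (Vec (6 * a) (6 * b) (6 * c) (6 * d))"
    using assms(3) by (induction ys) (auto split: if_splits)
  from assms(1,2) have "check_row f a b ys"
    by (induction xs) (auto split: if_splits)
  then show ?thesis by (rule row)
qed

lemma cmod_galois_ge:
  "\<bar>zr c (- d)\<bar> \<le> 2 * cmod (galois (Vec a b c d))" "\<bar>zr a (- b)\<bar> \<le> 2 * cmod (galois (Vec a b c d))"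
proof -
  have "\<bar>Im (galois (Vec a b c d))\<bar> \<le> cmod (galois (Vec a b c d))" by (rule abs_Im_le_cmod)
  then show "\<bar>zr c (- d)\<bar> \<le> 2 * cmod (galois (Vec a b c d))" by (simp add: omega_def)
  have "\<bar>Im (cnj omega * galois (Vec a b c d))\<bar> \<le> cmod (cnj omega * galois (Vec a b c d))" by (rule abs_Im_le_cmod)
  moreover have "Im (cnj omega * galois (Vec a b c d)) = - zr a (- b) / 2"
    by (simp add: omega_def algebra_simps)
  ultimately show "\<bar>zr a (- b)\<bar> \<le> 2 * cmod (galois (Vec a b c d))" by (simp add: norm_mult cmod_omega)
qed

lemma unit_coords:
  assumes "0 < zr a b" "zr a b < 1" "\<bar>zr a (- b)\<bar> \<le> 50"
  shows "(a, b) \<in> set unit_coords"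
proof -
  have "2 * of_int a = zr a b + zr a (- b)" by (simp add: zr_def)
  then have "- 51 < 2 * real_of_int a" "2 * real_of_int a < 52" using assms by linarith+
  then have a: "a \<in> {-25..25}" by auto
  have "2 * sqrt 3 * of_int b = zr a b - zr a (- b)" by (simp add: zr_def)
  then have "\<bar>2 * sqrt 3 * real_of_int b\<bar> < 51" using assms by linarith
  then have "\<bar>real_of_int b\<bar> * (2 * sqrt 3) < 51" by (simp add: abs_mult mult.commute)
  moreover have "\<bar>real_of_int b\<bar> * (346 / 100) \<le> \<bar>real_of_int b\<bar> * (2 * sqrt 3)"
    using sqrt3_bounds by (intro mult_left_mono) auto
  ultimately have "\<bar>real_of_int b\<bar> < 15" by linarith
  then have b: "b \<in> {-14..14}" by auto
  show ?thesis
    unfolding unit_coords_def set_filter set_product set_upto using a b assms(1,2) in_unit[of a b] by blast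
qed

lemma cmod_galois_sq:
  "(cmod (galois (Vec a b c d)))\<^sup>2 =
    zr (a * a + 3 * (b * b) + c * c + 3 * (d * d) + 3 * (a * d + b * c))
       (- 2 * (a * b) - 2 * (c * d) - (a * c + 3 * (b * d)))"
  unfolding cmod_power2 by (simp add: omega_def zr_def power2_eq_square algebra_simps)

lemma small_points_finite_orbit:
  assumes "pt p \<in> triangle" "cmod (galois p) \<le> 25"
  shows "finite_orbit (S n) (pt p)"
proof -
  obtain a b c d where p: "p = Vec a b c d" by (cases p)
  have t: "0 < zr a b" "0 < zr c d" "sqrt 3 * zr a b + zr c d < 1" using assms(1) by (auto simp: triangle_def p pt_V)
  have "1 * zr a b \<le> sqrt 3 * zr a b" using t by (intro mult_right_mono) auto
  then have u: "zr a b < 1" "zr c d < 1" using t by linarith+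
  have ab: "(a, b) \<in> set unit_coords" "(c, d) \<in> set unit_coords"
  proof -
    have g: "cmod (galois (Vec a b c d)) \<le> 25" using assms(2) by (simp only: p)
    show "(a, b) \<in> set unit_coords" "(c, d) \<in> set unit_coords"
      using cmod_galois_ge[where a = a and b = b and c = c and d = d] g t(1,2) u
      by (intro unit_coords; linarith)+
  qed
  have hyp: "0 < zr (1 - 3 * b - c) (- a - d)" using t(3) by (simp add: zr_def algebra_simps)
  have "(cmod (galois (Vec a b c d)))\<^sup>2 \<le> 25\<^sup>2" using assms(2) by (intro power_mono) (simp_all add: p del: galois.simps)
  then have ball: "zr (a * a + 3 * (b * b) + c * c + 3 * (d * d) + 3 * (a * d + b * c))
           (- 2 * (a * b) - 2 * (c * d) - (a * c + 3 * (b * d))) \<le> 625"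
    unfolding cmod_galois_sq by simp
  have "closes (if even n then stepv_e else stepv_o) 30 [] (Vec (6 * a) (6 * b) (6 * c) (6 * d))"
    using check_rows_closes[OF computed_points(1) ab hyp ball] check_rows_closes[OF computed_points(2) ab hyp ball] by simp
  then have "finite_orbit (S n) (vr (Vec (6 * a) (6 * b) (6 * c) (6 * d)))"
    by (rule closes_finite_orbit[rotated]) (auto simp: S_def stepv_e_def stepv_o_def vr_stepv)
  then show ?thesis using vr_six[of p] by (simp add: p)
qed

text \<open>
Between two visits to the scaled triangle there are at most 19 steps, each of which increases the
norm of the conjugate by at most \<open>7 / 2\<close>. Since \<open>26 + 19 * 7 / 2 = 185 / 2\<close> and
\<open>27 / 100 * (185 / 2) < 25\<close>, the norm bound \<open>25 + m\<close> improves by 1 with each renormalisation.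
\<close>

lemma galois_descent:
  "pt p \<in> triangle \<Longrightarrow> cmod (galois p) \<le> 25 + real m \<Longrightarrow> finite_orbit (step T_tree) (Phi n (pt p))"
proof (induction m arbitrary: n p)
  case 0
  then show ?case by (intro finite_orbit_level small_points_finite_orbit) simp_all
next
  case (Suc m)
  from cover_S[OF Suc.prems(1), of n] show ?case
  proof (elim disjE exE conjE bexE)
    assume "finite_orbit (S n) (pt p)"
    then show ?thesis by (intro finite_orbit_level Suc.prems(1))
  next
    fix j w assume j: "j \<le> 19" and w: "w \<in> triangle" "(S n ^^ j) (pt p) = kappa *\<^sub>R w"
    obtain q where q: "pt q = kappa *\<^sub>R w" "cmod (galois q) \<le> cmod (galois p) + real j * (7 / 2)"
      using step_lattice_iter[where U = S_even, OF S_acts(1), where j = j and p = p]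
        step_lattice_iter[where U = S_odd, OF S_acts(2), where j = j and p = p] w(2)
      by (auto simp: S_def split: if_splits)
    define p' where "p' = scalev (2, 1) q"
    have "zr2 (2, 1) *\<^sub>R (kappa *\<^sub>R w) = ((2 + sqrt 3) * kappa) *\<^sub>R w" by (simp add: zr_def)
    then have p': "pt p' = w" by (simp add: p'_def pt_scalev q(1) kappa_inv del: zr2.simps)
    have "zr 2 (- 1) = kappa" by (simp add: zr_def kappa_def)
    then have "cmod (galois p') = kappa * cmod (galois q)"
      using kappa_pos by (simp add: p'_def galois_scalev norm_mult)
    also have "\<dots> \<le> kappa * (185 / 2 + real m)"
      using q(2) Suc.prems(2) j kappa_pos by (intro mult_left_mono) auto
    also have "\<dots> \<le> 27 / 100 * (185 / 2 + real m)"
      using kappa_less by (intro mult_right_mono) auto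
    also have "\<dots> \<le> 25 + real m" by simp
    finally have "finite_orbit (step T_tree) (Phi (Suc n) (pt p'))"
      using w(1) p' by (intro Suc.IH) simp_all
    then have "finite_orbit (step T_tree) (Phi n ((S n ^^ j) (pt p)))" by (simp add: p' Phi_Suc w(2))
    then show ?thesis using level_iter[OF Suc.prems(1), where i = j and n = n] by (metis finite_orbit_funpow)
  qed
qed

section \<open>The map of the square\<close>

lemma T_square: "z \<in> square \<Longrightarrow> T z \<in> square"
  by (auto simp: square_def T_def frac_lt_1)

lemma step_T_tree:
  assumes "z \<in> square"
  shows "step T_tree z = T z"
proof -
  obtain x y where z: "z = (x, y)" by fastforce
  have b: "0 \<le> x" "x < 1" "0 \<le> y" "y < 1" using assms by (auto simp: square_def z)
  have "sqrt 3 * y \<le> sqrt 3" using b by simp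
  then have "x + sqrt 3 * y < 3" using b sqrt3_bounds by linarith
  moreover have "0 \<le> x + sqrt 3 * y" using b by simp
  ultimately have u: "0 \<le> x + sqrt 3 * y" "x + sqrt 3 * y < 3" by blast+
  have r: "(rot ^^ 5) z = (y, - x - sqrt 3 * y)"
    by (simp add: z rot_values)
  have fr: "T z = (y, - x - sqrt 3 * y + of_int k)" if "of_int k - 1 < x + sqrt 3 * y" "x + sqrt 3 * y \<le> of_int k" for k
  proof -
    have "floor (- x - sqrt 3 * y) = - k" using that by (intro floor_unique) auto
    then show ?thesis by (simp add: T_def z frac_def)
  qed
  show ?thesis
    using u fr[of 0] fr[of 1] fr[of 2] fr[of 3] r
    by (auto simp: step_def T_tree_def e_values z vr.simps zr_def)
qed

lemma step_T_tree_iter: "z \<in> square \<Longrightarrow> (step T_tree ^^ n) z = (T ^^ n) z \<and> (T ^^ n) z \<in> square"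
  by (induction n) (simp_all add: step_T_tree T_square)

lemma T_inj: "z \<in> square \<Longrightarrow> w \<in> square \<Longrightarrow> T z = T w \<Longrightarrow> z = w"
proof -
  assume sq: "z \<in> square" "w \<in> square" and eq: "T z = T w"
  obtain x y x' y' where zw: "z = (x, y)" "w = (x', y')" by fastforce
  have y: "y' = y" and f: "frac (- x - sqrt 3 * y) = frac (- x' - sqrt 3 * y)" using eq by (auto simp: T_def zw)
  have "x' - x = of_int (\<lfloor>- x - sqrt 3 * y\<rfloor> - \<lfloor>- x' - sqrt 3 * y\<rfloor>)" using f by (simp add: frac_def)
  moreover have "- 1 < x' - x" "x' - x < 1" using sq by (auto simp: square_def zw)
  ultimately have "\<lfloor>- x - sqrt 3 * y\<rfloor> - \<lfloor>- x' - sqrt 3 * y\<rfloor> = 0" by linarith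
  then show "z = w" using \<open>x' - x = _\<close> y zw by simp
qed

lemma period_finite_iff:
  assumes z: "z \<in> square"
  shows "period z \<noteq> \<infinity> \<longleftrightarrow> finite_orbit (step T_tree) z"
proof -
  have it: "(step T_tree ^^ n) z = (T ^^ n) z" for n using step_T_tree_iter[OF z] by blast
  have "finite_orbit (step T_tree) z \<longleftrightarrow> (\<exists>p\<ge>1. (T ^^ p) z = z)"
  proof
    assume "finite_orbit (step T_tree) z"
    then obtain i j where ij: "i < j" "(T ^^ i) z = (T ^^ j) z" unfolding finite_orbit_iff it by blast
    have "i < j \<Longrightarrow> (T ^^ i) z = (T ^^ j) z \<Longrightarrow> (T ^^ (j - i)) z = z" for i j
    proof (induction i arbitrary: j)
      case (Suc i)
      then obtain j' where j': "j = Suc j'" by (cases j) auto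
      have sq: "(T ^^ i) z \<in> square" "(T ^^ j') z \<in> square" using step_T_tree_iter[OF z] by blast+
      have "T ((T ^^ i) z) = T ((T ^^ j') z)" using Suc.prems(2) j' by simp
      then have "(T ^^ i) z = (T ^^ j') z" by (rule T_inj[OF sq])
      then show ?case using Suc.IH[of j'] Suc.prems j' by simp
    qed simp
    from this[OF ij] show "\<exists>p\<ge>1. (T ^^ p) z = z" using ij(1) by (intro exI[of _ "j - i"]) simp
  next
    assume "\<exists>p\<ge>1. (T ^^ p) z = z"
    then obtain p where "p \<ge> 1" "(T ^^ 0) z = (T ^^ p) z" by auto
    then show "finite_orbit (step T_tree) z" unfolding finite_orbit_iff it by (metis less_eq_Suc_le One_nat_def)
  qed
  then show ?thesis by (simp add: period_def)
qed

lemma lattice_iter: "\<exists>p'. pt p' = (step T_tree ^^ j) (pt p)"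
proof (induction j)
  case (Suc j)
  then obtain p' where p': "pt p' = (step T_tree ^^ j) (pt p)" by blast
  have "\<exists>k. a = Turn 5 (six (Vec 0 0 k 0))" if "a \<in> acts T_tree" for a
    using that by (auto simp: T_tree_def)
  then obtain k where "select T_tree (pt p') = Turn 5 (six (Vec 0 0 k 0))" using select_acts by blast
  then have "pt (addv (turnv 5 p') (Vec 0 0 k 0)) = step T_tree (pt p')"
    by (simp add: pt_addv pt_turnv step_def vr_six del: six.simps)
  then show ?case using p' by auto
qed auto

theorem lattice_period_finite:
  assumes "z \<in> square" "z = pt p"
  shows "period z \<noteq> \<infinity>"
  unfolding period_finite_iff[OF assms(1)]
  using cover_T[OF assms(1)]
proof (elim disjE exE bexE)
  fix j w assume w: "w \<in> triangle" "(step T_tree ^^ j) z = Phi 0 w"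
  obtain p' where p': "pt p' = Phi 0 w" using lattice_iter[of j p] w(2) assms(2) by auto
  have k2: "(7 + 4 * sqrt 3) * kappa ^ 2 = 1" by (simp add: kappa_def power2_eq_square algebra_simps)
  define q where "q = scalev (7, 4) (addv (Vec 1 0 1 0) (negv p'))"
  have neg: "pt (negv p') = - pt p'" by (simp add: pt_def vr_negv)
  have "pt q = (7 + 4 * sqrt 3) *\<^sub>R (kappa ^ 2 *\<^sub>R w)"
    by (simp add: q_def pt_scalev pt_addv neg p' Phi_def pt_V zr_def power2_eq_square del: scaleR_scaleR addv.simps)
  also have "\<dots> = w" by (simp only: scaleR_scaleR k2 scaleR_one)
  finally have q: "pt q = w" .
  obtain m :: nat where "cmod (galois q) \<le> real m" using real_arch_simple by blast
  then have "finite_orbit (step T_tree) (Phi 0 w)" using galois_descent[of q m 0] w(1) q by simp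
  then show "finite_orbit (step T_tree) z" using w(2) by (metis finite_orbit_funpow)
qed

section \<open>An infinite orbit\<close>

abbreviation orbit :: "('a \<Rightarrow> 'a) \<Rightarrow> 'a \<Rightarrow> 'a set" where
  "orbit f z \<equiv> range (\<lambda>i. (f ^^ i) z)"

lemma orbit_funpow: "orbit f ((f ^^ n) z) \<subseteq> orbit f z"
  by (auto simp flip: funpow_add[unfolded comp_def fun_eq_iff, rule_format])

text \<open>
The last piece is moved upwards, to points with second coordinate greater than \<open>kappa\<close>.
\<close>

lemma S_leaves_kappa_triangle:
  assumes w: "w \<in> triangle"
  shows "S n (kappa *\<^sub>R w) \<notin> (*\<^sub>R) kappa ` triangle"
proof -
  obtain x y where xy: "w = (x, y)" by fastforce
  have d: "0 < x" "0 < y" "sqrt 3 * x + y < 1" using w by (auto simp: triangle_def xy)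
  define X Y where "X = kappa * x" "Y = kappa * y"
  have D: "0 < X" "0 < Y" using d kappa_pos by (simp_all add: X_Y_def)
  have l: "sqrt 3 * X + Y < 2 - sqrt 3"
    using mult_strict_left_mono[OF d(3) kappa_pos] by (simp add: X_Y_def kappa_def algebra_simps)
  then have "sqrt 3 * (sqrt 3 * X + Y) < sqrt 3 * (2 - sqrt 3)" by (intro mult_strict_left_mono) simp_all
  then have l': "3 * X + sqrt 3 * Y < 2 * sqrt 3 - 3" by (simp add: algebra_simps)
  have no: "\<not> sqrt 3 - 1 < 2 * X + sqrt 3 * Y" "2 * X + sqrt 3 * Y \<noteq> sqrt 3 - 1" "\<not> 2 - sqrt 3 < sqrt 3 * X + Y"
    "sqrt 3 * X + Y \<noteq> 2 - sqrt 3" using D l l' sqrt3_bounds by linarith+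
  have "2 - sqrt 3 < snd (S n (X, Y))"
    using no l' D sqrt3_bounds
    by (auto simp: S_def step_def S_even_def S_odd_def even_tree_def odd_tree_def even_tail_def e_values zr_def vr.simps
        rot_values diff_divide_distrib)
  moreover have "snd u < 2 - sqrt 3" if u: "u \<in> (*\<^sub>R) kappa ` triangle" for u
  proof -
    from u obtain v where v: "v \<in> triangle" "u = kappa *\<^sub>R v" by blast
    obtain x y where xy: "v = (x, y)" by fastforce
    have "0 < x" "sqrt 3 * x + y < 1" using v by (auto simp: triangle_def xy)
    moreover from this have "0 < sqrt 3 * x" by simp
    ultimately have "y < 1" by linarith
    then have "snd v < 1" by (simp add: xy)
    then show ?thesis using v mult_strict_left_mono[of "snd v" 1 kappa] kappa_pos by (simp add: kappa_def)
  qed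
  ultimately show ?thesis by (fastforce simp: xy X_Y_def)
qed

text \<open>
The scaled orbit of \<open>w\<close> is contained in the orbit of \<open>kappa *\<^sub>R w\<close>, and it misses the first iterate
of \<open>kappa *\<^sub>R w\<close>.
\<close>

lemma orbit_decreases:
  assumes w: "w \<in> triangle" and reach: "(S n ^^ j) v = kappa *\<^sub>R w" and finite_orbit: "finite (orbit (S n) v)"
  shows "finite (orbit (S (Suc n)) w) \<and> card (orbit (S (Suc n)) w) < card (orbit (S n) v)"
proof -
  let ?small = "(*\<^sub>R) kappa ` orbit (S (Suc n)) w" and ?big = "orbit (S n) (kappa *\<^sub>R w)"
  have sub: "?small \<subseteq> ?big"
  proof
    fix u assume "u \<in> ?small"
    then obtain i where "u = kappa *\<^sub>R ((S (Suc n) ^^ i) w)" by blast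
    then show "u \<in> ?big" using S_iter[OF w, where i = i and n = n] by (metis rangeI)
  qed
  have "(S n ^^ 1) (kappa *\<^sub>R w) \<in> ?big" by (rule rangeI)
  moreover have "?small \<subseteq> (*\<^sub>R) kappa ` triangle" using S_triangle[OF w] by blast
  then have "(S n ^^ 1) (kappa *\<^sub>R w) \<notin> ?small" using S_leaves_kappa_triangle[OF w, of n] by auto
  ultimately have "?small \<subset> ?big" using sub by blast
  moreover have big: "?big \<subseteq> orbit (S n) v" using orbit_funpow[of "S n" j v] reach by simp
  ultimately have "card ?small < card (orbit (S n) v)"
    by (intro psubset_card_mono finite_orbit) blast
  moreover have inj: "inj_on ((*\<^sub>R) kappa) A" for A :: "(real \<times> real) set"
    using kappa_pos by (intro inj_onI) simp
  then have "card ?small = card (orbit (S (Suc n)) w)" by (rule card_image)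
  moreover have "finite ?small" by (rule finite_subset[OF subset_trans[OF sub big] finite_orbit])
  then have "finite (orbit (S (Suc n)) w)" using inj by (rule finite_imageD)
  ultimately show ?thesis by simp
qed

definition sevenths :: "int \<Rightarrow> int \<Rightarrow> int \<Rightarrow> int \<Rightarrow> real \<times> real" where
  "sevenths a b c d = (zr a b / 7, zr c d / 7)"

lemma S_sevenths_right:
  assumes "zpos (2 * a + 3 * d + 7) (2 * b + c - 7)"
    "zpos (3 * b + 2 * c - 7) (a + 2 * d) \<or> zpos (7 - 3 * b - 2 * c) (- a - 2 * d)"
  shows "S n (sevenths a b c d) = sevenths (7 - c - 3 * b) (- d - a) a b"
  using assms unfolding zpos_iff
  by (auto simp: S_def step_def S_even_def S_odd_def even_tree_def odd_tree_def sevenths_def e_values zr_def vr.simps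
      rot_values rot_def field_simps)

lemma S_sevenths_middle:
  assumes "zpos (- 2 * a - 3 * d - 7) (7 - 2 * b - c)" "zpos (3 * b + c - 14) (a + d + 7)"
  shows "S n (sevenths a b c d) = sevenths (3 * b + c - 14) (a + d + 7) (- 7 - a) (7 - b)"
  using assms unfolding zpos_iff
  by (auto simp: S_def step_def S_even_def S_odd_def even_tree_def odd_tree_def sevenths_def e_values zr_def vr.simps
      rot_values rot_def field_simps)

lemma kappa_sevenths: "kappa *\<^sub>R sevenths a b c d = sevenths (2 * a - 3 * b) (2 * b - a) (2 * c - 3 * d) (2 * d - c)"
  by (simp add: sevenths_def kappa_def zr_def field_simps)

lemma sevenths_triangle: "zpos a b \<Longrightarrow> zpos c d \<Longrightarrow> zpos (7 - 3 * b - c) (- a - d) \<Longrightarrow> sevenths a b c d \<in> triangle"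
  unfolding zpos_iff by (simp add: sevenths_def triangle_def zr_def field_simps)

text \<open>
The renormalisation cycle of the point \<open>(2/7, 1/7 + sqrt 3/7) = sevenths 2 0 1 1\<close>. Its orbits
up to the respective returns stay in the two larger open pieces.
\<close>

lemma sevenths_cycle:
  "(S 0 ^^ 3) (sevenths 2 0 1 1) = kappa *\<^sub>R sevenths (- 5) 3 (- 3) 5"
  "(S (Suc 0) ^^ 7) (sevenths (- 5) 3 (- 3) 5) = kappa *\<^sub>R sevenths (- 9) 6 (- 6) 6"
  "(S (Suc (Suc 0)) ^^ 1) (sevenths (- 9) 6 (- 6) 6) = kappa *\<^sub>R sevenths (- 1) 1 0 3"
  "(S (Suc (Suc (Suc 0))) ^^ 1) (sevenths (- 1) 1 0 3) = kappa *\<^sub>R sevenths 2 0 1 1"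
  by (simp_all add: numeral_eq_Suc kappa_sevenths S_sevenths_right S_sevenths_middle zpos_def)

lemma sevenths_infinite: "infinite (orbit (S 0) (sevenths 2 0 1 1))"
proof
  assume f0: "finite (orbit (S 0) (sevenths 2 0 1 1))"
  have t: "sevenths 2 0 1 1 \<in> triangle" "sevenths (- 5) 3 (- 3) 5 \<in> triangle" "sevenths (- 9) 6 (- 6) 6 \<in> triangle"
    "sevenths (- 1) 1 0 3 \<in> triangle"
    by (intro sevenths_triangle; simp add: zpos_def)+
  note f1 = orbit_decreases[OF t(2) sevenths_cycle(1) f0]
  note f2 = orbit_decreases[OF t(3) sevenths_cycle(2) conjunct1[OF f1]]
  note f3 = orbit_decreases[OF t(4) sevenths_cycle(3) conjunct1[OF f2]]
  note f4 = orbit_decreases[OF t(1) sevenths_cycle(4) conjunct1[OF f3]]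
  have period: "S (Suc (Suc (Suc (Suc 0)))) = S 0" by (simp add: S_def)
  show False
    using conjunct2[OF f1] conjunct2[OF f2] conjunct2[OF f3] conjunct2[OF f4] unfolding period by linarith
qed

lemma Phi_finite_orbit_imp:
  assumes w: "w \<in> triangle" and finite_orbit: "finite_orbit (step T_tree) (Phi 0 w)"
  shows "finite (orbit (S 0) w)"
proof -
  have "Phi 0 ` orbit (S 0) w \<subseteq> orbit (step T_tree) (Phi 0 w)"
    using level_iter[OF w, where n = 0] by (auto simp: image_iff) metis
  then have "finite (Phi 0 ` orbit (S 0) w)" using finite_orbit finite_subset unfolding finite_orbit_def by blast
  moreover have "inj (Phi 0)" using kappa_pos by (intro injI) (simp add: Phi_def)
  ultimately show ?thesis by (metis finite_imageD inj_on_subset subset_UNIV)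
qed

lemma inv_V: "inv V w = Phi 0 w"
proof -
  have k: "(2 - sqrt 3)\<^sup>2 > 0" using kappa_pos by (simp add: kappa_def)
  have "inj V" by (intro injI) (use k in \<open>simp add: V_def\<close>)
  moreover have "V (Phi 0 w) = w"
  proof -
    have "inverse kappa * inverse kappa * (kappa * kappa) = 1" using kappa_pos by (simp add: field_simps)
    then show ?thesis by (simp add: V_def Phi_def power2_eq_square flip: kappa_def)
  qed
  ultimately show ?thesis by (metis inv_f_f)
qed

theorem theorem10p1:
  "(\<forall>z \<in> (Z_sqrt3 \<inter> {0..<1}) \<times> (Z_sqrt3 \<inter> {0..<1}). period z \<noteq> \<infinity>) \<and>
   period (inv V (2 / 7, sqrt 3 / 7 + 1 / 7)) = \<infinity>"
proof
  show "\<forall>z \<in> (Z_sqrt3 \<inter> {0..<1}) \<times> (Z_sqrt3 \<inter> {0..<1}). period z \<noteq> \<infinity>"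
  proof
    fix z assume z: "z \<in> (Z_sqrt3 \<inter> {0..<1}) \<times> (Z_sqrt3 \<inter> {0..<1})"
    then obtain a b c d where "z = pt (Vec a b c d)"
      by (auto simp: Z_sqrt3_def pt_V zr_def)
    then show "period z \<noteq> \<infinity>" using z by (intro lattice_period_finite) (auto simp: square_def)
  qed
  let ?w = "sevenths 2 0 1 1"
  have w: "?w \<in> triangle" by (rule sevenths_triangle) (simp_all add: zpos_def)
  have "Phi 0 ?w \<in> square"
  proof -
    obtain x y where xy: "?w = (x, y)" by fastforce
    have d: "0 < x" "0 < y" "sqrt 3 * x + y < 1" using w by (auto simp: triangle_def xy)
    then have "x \<le> sqrt 3 * x" using mult_right_mono[of 1 "sqrt 3" x] by simp
    then have "x \<le> 1" "y \<le> 1" using d by linarith+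
    note d(1,2) this
    moreover have k: "0 < kappa * kappa" "kappa * kappa \<le> 1" using kappa_pos kappa_less by (simp_all add: mult_le_one)
    ultimately have "0 < kappa * kappa * x" "0 < kappa * kappa * y" "kappa * kappa * x \<le> 1" "kappa * kappa * y \<le> 1"
      using mult_pos_pos[OF k(1), of x] mult_pos_pos[OF k(1), of y] mult_le_one[OF k(2), of x] mult_le_one[OF k(2), of y]
      by linarith+
    then show ?thesis by (simp add: Phi_def square_def xy)
  qed
  then have "period (Phi 0 ?w) = \<infinity>"
    using period_finite_iff Phi_finite_orbit_imp[OF w] sevenths_infinite by blast
  moreover have "(2 / 7, sqrt 3 / 7 + 1 / 7) = ?w" by (simp add: sevenths_def zr_def field_simps)
  ultimately show "period (inv V (2 / 7, sqrt 3 / 7 + 1 / 7)) = \<infinity>" by (simp add: inv_V)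
qed

end
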